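(* Every finite simple graph $G$ with minimum degree $\delta(G)\ge 33$ admits an antimagic orientation.
   Context: All graphs are finite and simple; graphs are not assumed to be connected. $\delta(G)$ denotes the minimum degree of $G$. An orientation $D$ of a graph $G$ is a directed graph obtained by assigning one direction to each edge of $G$; $A(D)$ denotes its set of arcs. Let $D$ be a directed graph with $m$ arcs and let $\sigma: A(D)\to\mathbb{Z}$ be an injective labeling. The oriented vertex sum at a vertex $v$ is the sum of the labels of all arcs entering $v$ minus the sum of the labels of all arcs leaving $v$. An antimagic labeling of $D$ is a bijection $\sigma: A(D)\to\{1,\ldots,m\}$ such that the oriented vertex sums of all vertices of $D$ are pairwise distinct. A graph $G$ admits an antimagic orientation if some orientation of $G$ has an antimagic labeling. *)

theory Defs
  imports "Graph_Theory.Graph_Theory"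
begin

text \<open>
  A finite simple graph is a \<^locale>\<open>pair_graph\<close>, i.e. a finite symmetric loop-free digraph
  without parallel arcs: an undirected edge \<open>uv\<close> is the pair of arcs \<open>(u,v)\<close> and \<open>(v,u)\<close>.
  Hence the undirected degree of a vertex is its out-degree.

  For the null graph \<open>min_degree\<close> is the unspecified value \<open>Min {}\<close>.
\<close>

definition min_degree :: "'a pair_pre_digraph \<Rightarrow> nat" where
  "min_degree G = Min (out_degree (with_proj G) ` pverts G)"

definition orientation_of :: "'a pair_pre_digraph \<Rightarrow> 'a pair_pre_digraph \<Rightarrow> bool" where
  "orientation_of D G \<longleftrightarrow>
     pverts D = pverts G \<and> parcs D \<subseteq> parcs G \<and>
     (\<forall>u v. (u, v) \<in> parcs G \<longrightarrow> ((u, v) \<in> parcs D \<longleftrightarrow> (v, u) \<notin> parcs D))"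

definition oriented_vertex_sum :: "('a, 'b) pre_digraph \<Rightarrow> ('b \<Rightarrow> int) \<Rightarrow> 'a \<Rightarrow> int" where
  "oriented_vertex_sum D \<sigma> v = (\<Sum>a\<in>in_arcs D v. \<sigma> a) - (\<Sum>a\<in>out_arcs D v. \<sigma> a)"

definition antimagic_labeling :: "('a, 'b) pre_digraph \<Rightarrow> ('b \<Rightarrow> int) \<Rightarrow> bool" where
  "antimagic_labeling D \<sigma> \<longleftrightarrow>
     bij_betw \<sigma> (arcs D) {1..int (card (arcs D))} \<and>
     inj_on (oriented_vertex_sum D \<sigma>) (verts D)"

definition admits_antimagic_orientation :: "'a pair_pre_digraph \<Rightarrow> bool" where
  "admits_antimagic_orientation G \<longleftrightarrow>
     (\<exists>D \<sigma>. orientation_of D G \<and> antimagic_labeling (with_proj D) \<sigma>)"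

end

theory Submission
  imports Defs
begin

text \<open>
  In a maximum cut \<open>(X, Y)\<close> with \<open>|X| \<le> |Y|\<close> every vertex has at least 17 cross edges, and at least as
  many cross edges as inner ones. Orient the cross edges from \<open>X\<close> to \<open>Y\<close> and give the smallest labels
  to the inner edges: the sums on \<open>X\<close> are then negative and those on \<open>Y\<close> positive, so it remains to
  label the cross edges so that the sums within \<open>X\<close> and within \<open>Y\<close> differ, whatever the inner edges
  contribute.

  Use pairs of labels with constant sum \<open>C\<close>, one pair per level. Reserve three kinds of cross edges: a
  private edge for every vertex of \<open>Y\<close>; paths \<open>x - y - x'\<close> whose ends cover \<open>X\<close> and whose two edges
  share a level, so that \<open>y\<close> receives \<open>C\<close> independently of the level; and a set \<open>F\<close> of edges with even
  degrees, at most 6 on \<open>Y\<close>, decomposed into closed trails. In \<open>F\<close> the two edges of a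
  passage through \<open>X\<close> share a level, so that \<open>X\<close> sees only the constant \<open>C\<close>, while a passage through \<open>Y\<close>
  joins two levels that are at most two steps apart. All other labels are fixed beforehand.

  The private edges get labels with gaps of 7, in the order of the remaining sums on \<open>Y\<close>. Then levels
  for the paths are chosen greedily to make the sums on \<open>X\<close> distinct. No two of these levels are
  adjacent, so squeezing them in between the levels of \<open>F\<close> moves a passage through \<open>Y\<close> by at most 2,
  hence a sum on \<open>Y\<close> by at most 6, and the order on \<open>Y\<close> survives.
\<close>

section \<open>Balanced orientations and even subgraphs\<close>

text \<open>By induction on the number of edges: two edges \<open>u - v\<close> and \<open>v - w\<close> are replaced by one edge \<open>u - w\<close>,
  possibly a loop, whose direction is then given to both.\<close>

lemma balanced_orientation:
  fixes a b :: "'e \<Rightarrow> 'v"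
  assumes "finite E"
  shows "\<exists>s :: 'e \<Rightarrow> int. (\<forall>e. s e = 1 \<or> s e = -1) \<and>
    (\<forall>v. \<bar>\<Sum>e\<in>E. s e * (of_bool (a e = v) - of_bool (b e = v))\<bar> \<le> 1)"
  using assms
proof (induction "card E" arbitrary: E a b rule: less_induct)
  case less
  let ?P = "\<lambda>E (a :: 'e \<Rightarrow> 'v) b. \<exists>s :: 'e \<Rightarrow> int. (\<forall>e. s e = 1 \<or> s e = -1) \<and>
    (\<forall>v. \<bar>\<Sum>e\<in>E. s e * (of_bool (a e = v) - of_bool (b e = v))\<bar> \<le> 1)"
  \<comment> \<open>Exchanging the two ends of \<open>e\<close> is undone by negating its sign, so a
    shared end can always be brought into the form \<open>b e = a f\<close>.\<close>
  have flip: "?P E a b" if "?P E (a(e := b e)) (b(e := a e))" for a b e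
  proof -
    from that obtain s :: "'e \<Rightarrow> int" where s: "\<forall>e. s e = 1 \<or> s e = -1"
      and bal: "\<forall>v. \<bar>\<Sum>f\<in>E. s f * (of_bool ((a(e := b e)) f = v) - of_bool ((b(e := a e)) f = v))\<bar> \<le> 1"
      by blast
    have "(\<Sum>f\<in>E. (s(e := - s e)) f * (of_bool (a f = v) - of_bool (b f = v))) =
        (\<Sum>f\<in>E. s f * (of_bool ((a(e := b e)) f = v) - of_bool ((b(e := a e)) f = v)))" for v
      by (rule sum.cong) auto
    then show ?thesis
      using s bal by (intro exI[of _ "s(e := - s e)"]) auto
  qed
  \<comment> \<open>\<open>e\<close> becomes the merged edge from \<open>a e\<close> to
    \<open>b f\<close> and \<open>f\<close> is deleted. Giving \<open>f\<close> the sign of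
    \<open>e\<close> makes their contributions at the middle vertex \<open>b e = a f\<close>
    cancel.\<close>
  have split: "?P E a b" if e: "e \<in> E" "f \<in> E" "e \<noteq> f" "b e = a f" for a b :: "'e \<Rightarrow> 'v" and e f
  proof -
    have "card (E - {f}) < card E"
      using e less.prems by (intro psubset_card_mono) auto
    from less.hyps[OF this, of a "b(e := b f)"] less.prems
    obtain s :: "'e \<Rightarrow> int" where s: "\<forall>e. s e = 1 \<or> s e = -1"
      and bal: "\<forall>v. \<bar>\<Sum>g\<in>E - {f}. s g * (of_bool (a g = v) - of_bool ((b(e := b f)) g = v))\<bar> \<le> 1"
      by auto
    have "(\<Sum>g\<in>E. (s(f := s e)) g * (of_bool (a g = v) - of_bool (b g = v))) =
        (\<Sum>g\<in>E - {f}. s g * (of_bool (a g = v) - of_bool ((b(e := b f)) g = v)))" (is "?l = ?r") for v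
    proof -
      have E: "E = insert f (insert e (E - {e, f}))" "E - {f} = insert e (E - {e, f})"
        using e by auto
      have fin: "finite (E - {e, f})"
        using less.prems by auto
      have rest: "(\<Sum>g\<in>E - {e, f}. (s(f := s e)) g * (of_bool (a g = v) - of_bool (b g = v))) =
          (\<Sum>g\<in>E - {e, f}. s g * (of_bool (a g = v) - of_bool ((b(e := b f)) g = v)))"
        by (rule sum.cong) auto
      have "?l = s e * (of_bool (a f = v) - of_bool (b f = v)) + (s e * (of_bool (a e = v) - of_bool (b e = v))
          + (\<Sum>g\<in>E - {e, f}. (s(f := s e)) g * (of_bool (a g = v) - of_bool (b g = v))))"
        using e fin by (subst E(1), subst sum.insert) (auto simp: sum.insert)
      moreover have "?r = s e * (of_bool (a e = v) - of_bool (b f = v))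
          + (\<Sum>g\<in>E - {e, f}. s g * (of_bool (a g = v) - of_bool ((b(e := b f)) g = v)))"
        using e fin by (subst E(2), subst sum.insert) auto
      ultimately show ?thesis
        unfolding rest using e(4) by (simp add: algebra_simps)
    qed
    then show ?thesis
      using s bal by (intro exI[of _ "s(f := s e)"]) auto
  qed
  show ?case
  proof (cases "\<exists>e\<in>E. \<exists>f\<in>E. e \<noteq> f \<and> {a e, b e} \<inter> {a f, b f} \<noteq> {}")
    case True
    then obtain e f where e: "e \<in> E" "f \<in> E" "e \<noteq> f" and "{a e, b e} \<inter> {a f, b f} \<noteq> {}"
      by blast
    then consider "b e = a f" | "b e = b f" | "a e = a f" | "a e = b f"
      by auto
    then show ?thesis
    proof cases
      case 1
      then show ?thesis using split e by blast
    next
      case 2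
      then show ?thesis using e by (intro flip[of a f b] split[of e f]) auto
    next
      case 3
      then show ?thesis using e by (intro flip[of a e b] split[of e f]) auto
    next
      case 4
      then show ?thesis using e by (intro split[of f e]) auto
    qed
  next
    \<comment> \<open>Distinct edges have no common end here, so each vertex sees at most one edge,
      and a loop contributes 0.\<close>
    case False
    have "\<bar>\<Sum>e\<in>E. 1 * (of_bool (a e = v) - of_bool (b e = v)) :: int\<bar> \<le> 1" for v
    proof (cases "\<exists>e\<in>E. v \<in> {a e, b e}")
      case True
      then obtain e where e: "e \<in> E" "v \<in> {a e, b e}" by blast
      have "(\<Sum>f\<in>E - {e}. 1 * (of_bool (a f = v) - of_bool (b f = v)) :: int) = 0"
        using False e by (intro sum.neutral) auto
      then show ?thesis
        using less.prems e by (subst sum.remove[of _ e]) auto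
    next
      case False
      then have "(\<Sum>e\<in>E. 1 * (of_bool (a e = v) - of_bool (b e = v)) :: int) = 0"
        by (intro sum.neutral) auto
      then show ?thesis by simp
    qed
    then show ?thesis
      by (intro exI[of _ "\<lambda>_. 1"]) auto
  qed
qed

text \<open>In a balanced orientation let \<open>H\<close> consist of the edges directed from the
  first side to the second. Out-degree minus in-degree is then, up to sign, the difference of the
  degrees in \<open>H\<close> and in \<open>E - H\<close>. The tags \<open>Inl\<close> and
  \<open>Inr\<close> keep the two sides apart even if their types agree.\<close>

lemma bipartite_balanced_halving:
  fixes E :: "('a \<times> 'b) set"
  assumes "finite E"
  obtains H where "H \<subseteq> E"
    "\<And>x. \<bar>int (card {e \<in> H. fst e = x}) - int (card {e \<in> E - H. fst e = x})\<bar> \<le> 1"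
    "\<And>y. \<bar>int (card {e \<in> H. snd e = y}) - int (card {e \<in> E - H. snd e = y})\<bar> \<le> 1"
proof -
  obtain s :: "'a \<times> 'b \<Rightarrow> int" where s: "\<And>e. s e = 1 \<or> s e = -1" and
    bal: "\<And>v. \<bar>\<Sum>e\<in>E. s e * (of_bool (Inl (fst e) = v) - of_bool (Inr (snd e) = v))\<bar> \<le> 1"
    using balanced_orientation[OF assms, of "\<lambda>e. Inl (fst e)" "\<lambda>e. Inr (snd e)"] by blast
  define H where "H = {e \<in> E. s e = 1}"
  have H: "H \<subseteq> E" by (auto simp: H_def)
  have fin: "finite H" "finite (E - H)" using assms H finite_subset by auto
  have diff: "int (card {e \<in> H. P e}) - int (card {e \<in> E - H. P e}) = (\<Sum>e\<in>E. s e * of_bool (P e))" for P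
  proof -
    have "(\<Sum>e\<in>E. s e * of_bool (P e)) = (\<Sum>e\<in>H. s e * of_bool (P e)) + (\<Sum>e\<in>E - H. s e * of_bool (P e))"
      using assms H by (subst sum.subset_diff[of H E]) auto
    also have "(\<Sum>e\<in>H. s e * of_bool (P e)) = (\<Sum>e\<in>H. of_bool (P e))"
      by (rule sum.cong) (auto simp: H_def)
    also have "(\<Sum>e\<in>E - H. s e * of_bool (P e)) = - (\<Sum>e\<in>E - H. of_bool (P e))"
      using s by (subst sum_negf[symmetric], intro sum.cong) (auto simp: H_def)
    finally show ?thesis
      using fin by (simp add: sum_of_bool_eq Int_def)
  qed
  have x: "\<bar>int (card {e \<in> H. fst e = x}) - int (card {e \<in> E - H. fst e = x})\<bar> \<le> 1" for x
    using bal[of "Inl x"] unfolding diff by simp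
  have y: "\<bar>int (card {e \<in> H. snd e = y}) - int (card {e \<in> E - H. snd e = y})\<bar> \<le> 1" for y
    using bal[of "Inr y"] unfolding diff by (simp add: sum_negf)
  show ?thesis
    using H x y by (rule that)
qed

lemma even_card_symdiff:
  assumes "finite A" "finite B"
  shows "even (card ((A - B) \<union> (B - A))) \<longleftrightarrow> (even (card A) \<longleftrightarrow> even (card B))"
proof -
  have "card ((A - B) \<union> (B - A)) = card (A - B) + card (B - A)"
    using assms by (intro card_Un_disjoint) auto
  moreover have "card A = card (A - B) + card (A \<inter> B)"
    using assms by (metis Diff_disjoint Int_Diff_Un Int_commute card_Un_disjoint finite_Diff finite_Int inf_assoc inf_bot_right sup_commute)
  moreover have "card B = card (B - A) + card (A \<inter> B)"
    using assms by (metis Diff_disjoint Int_Diff_Un Int_commute card_Un_disjoint finite_Diff finite_Int inf_assoc inf_bot_right sup_commute)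
  ultimately show ?thesis by auto
qed

text \<open>No vertex sets are mentioned: outside them the fibres are empty and hence even.\<close>

definition even_degrees :: "('a \<times> 'b) set \<Rightarrow> bool" where
  "even_degrees F \<longleftrightarrow>
     (\<forall>x. even (card {e \<in> F. fst e = x})) \<and> (\<forall>y. even (card {e \<in> F. snd e = y}))"

text \<open>There are more subsets of \<open>J\<close> than parity patterns of degrees; two subsets with the same
  pattern differ in an even one.\<close>

lemma nonempty_even_subset:
  assumes "finite X" "finite Y" "J \<subseteq> X \<times> Y" "card J > card X + card Y"
  obtains F where "F \<subseteq> J" "F \<noteq> {}" "even_degrees F"
proof -
  have finJ: "finite J" using assms by (meson finite_SigmaI finite_subset)
  define par where "par A = ({x \<in> X. odd (card {e \<in> A. fst e = x})}, {y \<in> Y. odd (card {e \<in> A. snd e = y})})"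
    for A :: "('a \<times> 'b) set"
  have "card (Pow X \<times> Pow Y) = 2 ^ (card X + card Y)"
    using assms by (simp add: card_cartesian_product card_Pow power_add)
  also have "\<dots> < 2 ^ card J" using assms by simp
  also have "\<dots> = card (Pow J)" using finJ by (simp add: card_Pow)
  finally have "card (Pow X \<times> Pow Y) < card (Pow J)" .
  moreover have "par ` Pow J \<subseteq> Pow X \<times> Pow Y" by (auto simp: par_def)
  ultimately have "\<not> inj_on par (Pow J)"
    using assms card_inj_on_le[of par "Pow J" "Pow X \<times> Pow Y"] by auto
  then obtain A B where AB: "A \<subseteq> J" "B \<subseteq> J" "A \<noteq> B" "par A = par B"
    by (auto simp: inj_on_def)
  define F where "F = (A - B) \<union> (B - A)"
  have fin: "finite A" "finite B" using AB finJ finite_subset by auto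
  have set: "{e \<in> F. P e} = ({e \<in> A. P e} - {e \<in> B. P e}) \<union> ({e \<in> B. P e} - {e \<in> A. P e})" for P
    by (auto simp: F_def)
  have par: "even (card {e \<in> F. P e}) \<longleftrightarrow> (even (card {e \<in> A. P e}) \<longleftrightarrow> even (card {e \<in> B. P e}))" for P
    unfolding set using fin by (intro even_card_symdiff) auto
  have "even (card {e \<in> F. fst e = x})" for x
  proof (cases "x \<in> X")
    case True
    then show ?thesis using AB(4) unfolding par by (auto simp: par_def set_eq_iff)
  next
    case False
    then have "{e \<in> F. fst e = x} = {}" using AB assms by (auto simp: F_def)
    then show ?thesis by (metis card.empty even_zero)
  qed
  moreover have "even (card {e \<in> F. snd e = y})" for y
  proof (cases "y \<in> Y")
    case True
    then show ?thesis using AB(4) unfolding par by (auto simp: par_def set_eq_iff)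
  next
    case False
    then have "{e \<in> F. snd e = y} = {}" using AB assms by (auto simp: F_def)
    then show ?thesis by (metis card.empty even_zero)
  qed
  ultimately show ?thesis
    using AB by (intro that[of F]) (auto simp: F_def even_degrees_def)
qed

text \<open>Take a maximum even \<open>F\<close>. If more than \<open>card X + card Y\<close> edges
  were left, they would contain a nonempty even subset, and adding it to \<open>F\<close> would give
  a larger even set.\<close>

lemma large_even_subset:
  assumes "finite X" "finite Y" "E \<subseteq> X \<times> Y"
  obtains F where "F \<subseteq> E" "even_degrees F" "card E \<le> card F + card X + card Y"
proof -
  have finE: "finite E" using assms by (meson finite_SigmaI finite_subset)
  define \<F> where "\<F> = {F. F \<subseteq> E \<and> even_degrees F}"
  have "finite \<F>" using finE by (simp add: \<F>_def)
  moreover have "{} \<in> \<F>" by (simp add: \<F>_def even_degrees_def)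
  ultimately obtain F where F: "F \<in> \<F>" and max: "\<And>F'. F' \<in> \<F> \<Longrightarrow> card F' \<le> card F"
    using Max_in[of "card ` \<F>"] Max_ge[of "card ` \<F>"] by (smt (verit) empty_iff finite_imageI imageE imageI)
  have finF: "finite F" "F \<subseteq> E" using F finE finite_subset by (auto simp: \<F>_def)
  have "card (E - F) \<le> card X + card Y"
  proof (rule ccontr)
    assume "\<not> ?thesis"
    then obtain F' where F': "F' \<subseteq> E - F" "F' \<noteq> {}" "even_degrees F'"
      using nonempty_even_subset[of X Y "E - F"] assms by (metis Diff_subset not_le subset_trans)
    have finF': "finite F'" using F' finE finite_subset by auto
    have split: "card {e \<in> F \<union> F'. P e} = card {e \<in> F. P e} + card {e \<in> F'. P e}" for P
    proof -
      have "{e \<in> F \<union> F'. P e} = {e \<in> F. P e} \<union> {e \<in> F'. P e}" by auto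
      then show ?thesis using F' finF finF' by (auto intro!: card_Un_disjoint)
    qed
    have "F \<union> F' \<in> \<F>"
      using F F' unfolding \<F>_def even_degrees_def mem_Collect_eq split by auto
    moreover have "card (F \<union> F') = card F + card F'"
      using finF finF' F' by (intro card_Un_disjoint) auto
    ultimately show False
      using max[of "F \<union> F'"] F' finF' by (simp add: card_gt_0_iff)
  qed
  moreover have "card E = card F + card (E - F)"
    using finE finF by (simp add: card_Diff_subset card_mono)
  ultimately show ?thesis
    using F by (intro that[of F]) (auto simp: \<F>_def)
qed

text \<open>Each cycle is laid out as a zigzag: up on the even places and back on the odd ones.\<close>

lemma permutation_bandwidth_2:
  assumes "finite A" "bij_betw \<sigma> A A"
  shows "\<exists>pos :: 'a \<Rightarrow> nat. bij_betw pos A {..<card A} \<and>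
    (\<forall>a\<in>A. \<bar>int (pos (\<sigma> a)) - int (pos a)\<bar> \<le> 2)"
  using assms
proof (induction "card A" arbitrary: A rule: less_induct)
  case less
  show ?case
  proof (cases "A = {}")
    case True
    then show ?thesis by (simp add: bij_betw_def)
  next
    case False
    then obtain a where a: "a \<in> A" by blast
    have in_A: "(\<sigma> ^^ i) a \<in> A" for i
      using less.prems(2) a by (induction i) (auto simp: bij_betw_def)
    have inj: "inj_on \<sigma> A" using less.prems(2) by (simp add: bij_betw_def)
    have shift: "(\<sigma> ^^ i) a = (\<sigma> ^^ j) a \<Longrightarrow> i \<le> j \<Longrightarrow> (\<sigma> ^^ (j - i)) a = a" for i j
    proof (induction i arbitrary: j)
      case (Suc i)
      then obtain j' where j: "j = Suc j'" by (cases j) auto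
      with Suc.prems have "\<sigma> ((\<sigma> ^^ i) a) = \<sigma> ((\<sigma> ^^ j') a)" by simp
      then have "(\<sigma> ^^ i) a = (\<sigma> ^^ j') a" using inj in_A by (auto dest: inj_onD)
      then show ?case using Suc.IH[of j'] Suc.prems j by simp
    qed auto
    have "finite (range (\<lambda>i. (\<sigma> ^^ i) a))"
      using less.prems(1) in_A by (auto intro: finite_subset[of _ A])
    then have "\<not> inj (\<lambda>i. (\<sigma> ^^ i) a)"
      using finite_imageD infinite_UNIV_nat by blast
    then obtain i j where ij: "(\<sigma> ^^ i) a = (\<sigma> ^^ j) a" "i \<noteq> j"
      by (auto simp: inj_def)
    have "\<exists>i j. (\<sigma> ^^ i) a = (\<sigma> ^^ j) a \<and> i < j"
      using ij by (metis linorder_neqE_nat)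
    then obtain i j where "(\<sigma> ^^ i) a = (\<sigma> ^^ j) a" "i < j" by blast
    then have "\<exists>n>0. (\<sigma> ^^ n) a = a"
      using shift[of i j] by (intro exI[of _ "j - i"]) auto
    \<comment> \<open>\<open>n\<close> is the length of the cycle through \<open>a\<close>, which is
      split off before the induction hypothesis is applied to the rest.\<close>
    then obtain n where n: "n > 0" "(\<sigma> ^^ n) a = a" and least: "\<And>m. 0 < m \<Longrightarrow> (\<sigma> ^^ m) a = a \<Longrightarrow> n \<le> m"
      using exists_least_iff[of "\<lambda>n. n > 0 \<and> (\<sigma> ^^ n) a = a"] by (meson not_le)
    define c where "c i = (\<sigma> ^^ i) a" for i
    have c_inj: "inj_on c {..<n}"
    proof (rule linorder_inj_onI)
      fix i j assume ij: "i < j" "i \<in> {..<n}" "j \<in> {..<n}"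
      show "c i \<noteq> c j"
      proof
        assume "c i = c j"
        then have "(\<sigma> ^^ (j - i)) a = a" using shift[of i j] ij by (simp add: c_def)
        with least[of "j - i"] ij show False by auto
      qed
    qed auto
    define C where "C = c ` {..<n}"
    have bij_c: "bij_betw c {..<n} C" using c_inj by (simp add: C_def bij_betw_def)
    have card_C: "card C = n" using bij_betw_same_card[OF bij_c] by simp
    have C_sub: "C \<subseteq> A" using in_A by (auto simp: C_def c_def)
    have step: "\<sigma> (c i) = (if Suc i = n then c 0 else c (Suc i))" for i
      using n by (auto simp: c_def)
    have "\<sigma> ` C \<subseteq> C"
    proof
      fix x assume "x \<in> \<sigma> ` C"
      then obtain i where "i < n" "x = \<sigma> (c i)" by (auto simp: C_def)
      then show "x \<in> C" using n by (auto simp: C_def step)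
    qed
    then have "\<sigma> ` C = C"
      using inj C_sub less.prems(1) by (meson endo_inj_surj finite_subset inj_on_subset)
    then have "bij_betw \<sigma> C C" using inj C_sub by (auto simp: bij_betw_def inj_on_subset)
    then have bij_rest: "bij_betw \<sigma> (A - C) (A - C)"
      using bij_betw_DiffI[OF less.prems(2)] C_sub by blast
    have "card C > 0" using card_C n by simp
    have fin: "finite C" "finite (A - C)" using less.prems(1) C_sub finite_subset by auto
    have card_A: "card A = card (A - C) + n"
      using card_Diff_subset[OF fin(1) C_sub] card_mono[OF less.prems(1) C_sub] card_C by simp
    have "card (A - C) < card A" using card_A n by simp
    from less.hyps[OF this fin(2) bij_rest] obtain pos
      where pos: "bij_betw pos (A - C) {..<card (A - C)}"
        "\<And>x. x \<in> A - C \<Longrightarrow> \<bar>int (pos (\<sigma> x)) - int (pos x)\<bar> \<le> 2"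
      by blast
    \<comment> \<open>The cycle visits 0, 2, 4, ... and returns through the odd places. The two
      places at the turn differ by 1, and if \<open>n > 1\<close> the last place is 1, next to the
      start at 0.\<close>
    define z where "z i = (if 2 * i < n then 2 * i else 2 * (n - i) - 1)" for i
    have "inj_on z {..<n}"
    proof (rule inj_onI)
      fix i j assume "i \<in> {..<n}" "j \<in> {..<n}" and z: "z i = z j"
      then have ij: "i < n" "j < n" by auto
      have ev: "even (z k) \<longleftrightarrow> 2 * k < n" if "k < n" for k
        using that by (auto simp: z_def)
      show "i = j"
        using z ev[OF ij(1)] ev[OF ij(2)] ij by (cases "2 * i < n") (auto simp: z_def)
    qed
    moreover have "z ` {..<n} \<subseteq> {..<n}" by (auto simp: z_def)
    ultimately have bij_z: "bij_betw z {..<n} {..<n}"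
      by (simp add: bij_betw_def endo_inj_surj)
    define idx where "idx = inv_into {..<n} c"
    have idx: "bij_betw idx C {..<n}" unfolding idx_def by (rule bij_betw_inv_into[OF bij_c])
    have idx_c: "i < n \<Longrightarrow> idx (c i) = i" for i unfolding idx_def using c_inj by simp
    define pos' where "pos' x = (if x \<in> C then card (A - C) + z (idx x) else pos x)" for x
    have pos'_c: "pos' (c i) = card (A - C) + z i" if "i < n" for i
      using that by (simp add: pos'_def idx_c C_def)
    have bij1: "bij_betw pos' (A - C) {..<card (A - C)}"
      using pos(1) by (rule bij_betw_cong[THEN iffD1, rotated]) (simp add: pos'_def)
    have "bij_betw (\<lambda>i. card (A - C) + i) {..<n} {card (A - C)..<card (A - C) + n}"
      by (rule bij_betwI[where g = "\<lambda>i. i - card (A - C)"]) auto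
    from bij_betw_trans[OF bij_betw_trans[OF idx bij_z] this]
    have bij2: "bij_betw pos' C {card (A - C)..<card (A - C) + n}"
      by (rule bij_betw_cong[THEN iffD1, rotated]) (simp add: pos'_def)
    have "bij_betw pos' ((A - C) \<union> C) ({..<card (A - C)} \<union> {card (A - C)..<card (A - C) + n})"
      by (rule bij_betw_combine[OF bij1 bij2]) auto
    also have "(A - C) \<union> C = A" using C_sub by auto
    also have "{..<card (A - C)} \<union> {card (A - C)..<card (A - C) + n} = {..<card A}"
      unfolding card_A by auto
    finally have bij: "bij_betw pos' A {..<card A}" .
    moreover have "\<bar>int (pos' (\<sigma> x)) - int (pos' x)\<bar> \<le> 2" if x: "x \<in> A" for x
    proof (cases "x \<in> C")
      case True
      then obtain i where i: "i < n" "x = c i" by (auto simp: C_def)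
      show ?thesis
      proof (cases "Suc i = n")
        case True
        then have "pos' (\<sigma> x) = card (A - C) + z 0" "pos' x = card (A - C) + z i"
          using i n step[of i] by (simp_all add: pos'_c)
        then show ?thesis using True by (auto simp: z_def)
      next
        case False
        then have "pos' (\<sigma> x) = card (A - C) + z (Suc i)" "pos' x = card (A - C) + z i"
          using i n step[of i] by (simp_all add: pos'_c)
        then show ?thesis using False i(1) by (auto simp: z_def)
      qed
    next
      case False
      then have "\<sigma> x \<in> A - C" using x bij_betw_apply[OF bij_rest, of x] by blast
      then show ?thesis using pos(2)[of x] x False by (simp add: pos'_def)
    qed
    ultimately show ?thesis by blast
  qed
qed

text \<open>Bijections between corresponding fibres are glued together. This serves to pair the
  edges of two classes at each vertex.\<close>

lemma bij_betw_matching_fibers: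
  assumes "finite A" "finite B"
    and "\<And>v. card {a \<in> A. f a = v} = card {b \<in> B. g b = v}"
  obtains h where "bij_betw h A B" "\<And>a. a \<in> A \<Longrightarrow> g (h a) = f a"
proof -
  have "\<exists>h. bij_betw h {a \<in> A. f a = v} {b \<in> B. g b = v}" for v
    by (intro finite_same_card_bij assms(3)) (simp_all add: assms(1,2))
  then obtain h where h: "\<And>v. bij_betw (h v) {a \<in> A. f a = v} {b \<in> B. g b = v}"
    by metis
  have hB: "h (f a) a \<in> B" "g (h (f a) a) = f a" if "a \<in> A" for a
    using bij_betw_apply[OF h[of "f a"], of a] that by simp_all
  have "inj_on (\<lambda>a. h (f a) a) A"
  proof (rule inj_onI)
    fix a a' assume a: "a \<in> A" "a' \<in> A" "h (f a) a = h (f a') a'"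
    then have "f a = f a'" using hB by metis
    with a show "a = a'"
      using inj_onD[OF bij_betw_imp_inj_on[OF h[of "f a"]], of a a'] by simp
  qed
  moreover have "b \<in> (\<lambda>a. h (f a) a) ` A" if "b \<in> B" for b
  proof -
    have "b \<in> h (g b) ` {a \<in> A. f a = g b}"
      using that by (simp add: bij_betw_imp_surj_on[OF h])
    then obtain a where "a \<in> A" "f a = g b" "b = h (g b) a" by blast
    then have "b = h (f a) a" by simp
    then show ?thesis using \<open>a \<in> A\<close> by (rule image_eqI)
  qed
  ultimately have "bij_betw (\<lambda>a. h (f a) a) A B"
    using hB(1) unfolding bij_betw_def by blast
  then show ?thesis using hB(2) by (rule that)
qed

text \<open>With even degrees the balanced halving is exact, so the edges of \<open>H\<close> are
  matched with those of \<open>F - H\<close> at their ends in the first component by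
  \<open>h\<close> and in the second by \<open>k\<close>. The cycles of \<open>k \<circ> h\<close>
  are closed trails, and numbering \<open>H\<close> with bandwidth 2 gives the indices:
  \<open>lo i\<close> is the edge of \<open>H\<close> with number \<open>i\<close>,
  \<open>hi i\<close> its \<open>h\<close>-partner, and \<open>\<tau> i\<close> the number of the
  edge of \<open>H\<close> that follows.\<close>

lemma even_degrees_zigzag:
  assumes fin: "finite F" and ev: "even_degrees F"
  obtains K lo hi \<tau> where "card F = 2 * K"
    "inj_on lo {..<K}" "inj_on hi {..<K}"
    "lo ` {..<K} \<inter> hi ` {..<K} = {}" "lo ` {..<K} \<union> hi ` {..<K} = F"
    "\<forall>i<K. fst (hi i) = fst (lo i)"
    "bij_betw \<tau> {..<K} {..<K}"
    "\<forall>i<K. snd (lo (\<tau> i)) = snd (hi i)"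
    "\<forall>i<K. \<bar>int (\<tau> i) - int i\<bar> \<le> 2"
proof -
  obtain H where H: "H \<subseteq> F"
    and bal: "\<And>x. \<bar>int (card {e \<in> H. fst e = x}) - int (card {e \<in> F - H. fst e = x})\<bar> \<le> 1"
      "\<And>y. \<bar>int (card {e \<in> H. snd e = y}) - int (card {e \<in> F - H. snd e = y})\<bar> \<le> 1"
    using bipartite_balanced_halving[OF fin] by blast
  have finH: "finite H" "finite (F - H)" using fin H finite_subset by auto
  have eq: "card {e \<in> H. P e} = card {e \<in> F - H. P e}"
    if "even (card {e \<in> F. P e})" "\<bar>int (card {e \<in> H. P e}) - int (card {e \<in> F - H. P e})\<bar> \<le> 1" for P
  proof -
    have "{e \<in> F. P e} = {e \<in> H. P e} \<union> {e \<in> F - H. P e}" using H by auto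
    then have "card {e \<in> F. P e} = card {e \<in> H. P e} + card {e \<in> F - H. P e}"
      using finH by (auto intro!: card_Un_disjoint)
    with that show ?thesis by presburger
  qed
  have "card {e \<in> H. fst e = x} = card {e \<in> F - H. fst e = x}" for x
    using eq[of "\<lambda>e. fst e = x"] ev bal(1)[of x] unfolding even_degrees_def by blast
  from bij_betw_matching_fibers[OF finH this]
  obtain h where h: "bij_betw h H (F - H)" "\<And>e. e \<in> H \<Longrightarrow> fst (h e) = fst e"
    by blast
  have "card {e \<in> F - H. snd e = y} = card {e \<in> H. snd e = y}" for y
    using eq[of "\<lambda>e. snd e = y"] ev bal(2)[of y] unfolding even_degrees_def by metis
  from bij_betw_matching_fibers[OF finH(2,1) this]
  obtain k where k: "bij_betw k (F - H) H" "\<And>e. e \<in> F - H \<Longrightarrow> snd (k e) = snd e"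
    by blast
  have kh: "bij_betw (k \<circ> h) H H" by (rule bij_betw_trans[OF h(1) k(1)])
  obtain pos where pos: "bij_betw pos H {..<card H}"
    "\<And>e. e \<in> H \<Longrightarrow> \<bar>int (pos (k (h e))) - int (pos e)\<bar> \<le> 2"
    using permutation_bandwidth_2[OF finH(1) kh] by auto
  define lo where "lo = inv_into H pos"
  have lo: "bij_betw lo {..<card H} H" unfolding lo_def by (rule bij_betw_inv_into[OF pos(1)])
  have hi: "bij_betw (h \<circ> lo) {..<card H} (F - H)" by (rule bij_betw_trans[OF lo h(1)])
  have \<tau>: "bij_betw (pos \<circ> (k \<circ> h) \<circ> lo) {..<card H} {..<card H}"
    using bij_betw_trans[OF lo bij_betw_trans[OF kh pos(1)]] by (simp add: comp_assoc)
  have loH: "lo i \<in> H" "pos (lo i) = i" if "i < card H" for i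
    using that lo pos(1) by (auto simp: lo_def bij_betw_def f_inv_into_f)
  have hF: "h e \<in> F - H" if "e \<in> H" for e
    using that by (rule bij_betw_apply[OF h(1)])
  have khH: "k (h e) \<in> H" if "e \<in> H" for e
    using hF[OF that] by (rule bij_betw_apply[OF k(1)])
  have lo_pos: "lo (pos e) = e" if "e \<in> H" for e
    using that pos(1) by (simp add: lo_def bij_betw_def)
  have "card F = card H + card (F - H)"
    using H fin finH by (simp add: card_Diff_subset card_mono)
  also have "card (F - H) = card H" using bij_betw_same_card[OF h(1)] by simp
  finally have "card F = 2 * card H" by simp
  then show ?thesis
  proof (rule that[of "card H" lo "h \<circ> lo" "pos \<circ> (k \<circ> h) \<circ> lo"])
    show "lo ` {..<card H} \<inter> (h \<circ> lo) ` {..<card H} = {}"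
      unfolding bij_betw_imp_surj_on[OF lo] bij_betw_imp_surj_on[OF hi] by blast
    show "lo ` {..<card H} \<union> (h \<circ> lo) ` {..<card H} = F"
      unfolding bij_betw_imp_surj_on[OF lo] bij_betw_imp_surj_on[OF hi] using H by blast
    show "bij_betw (pos \<circ> (k \<circ> h) \<circ> lo) {..<card H} {..<card H}" by fact
    show "\<forall>i<card H. snd (lo ((pos \<circ> (k \<circ> h) \<circ> lo) i)) = snd ((h \<circ> lo) i)"
      by (simp add: lo_pos[OF khH] k(2)[OF hF] loH(1) del: Diff_iff)
    show "\<forall>i<card H. \<bar>int ((pos \<circ> (k \<circ> h) \<circ> lo) i) - int i\<bar> \<le> 2"
      using pos(2)[OF loH(1)] loH(2) by simp
    show "inj_on lo {..<card H}" "inj_on (h \<circ> lo) {..<card H}"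
      by (rule bij_betw_imp_inj_on[OF lo], rule bij_betw_imp_inj_on[OF hi])
    show "\<forall>i<card H. fst ((h \<circ> lo) i) = fst (lo i)"
      using h(2)[OF loH(1)] by simp
  qed
qed

section \<open>Enumerating free levels and ranking by sums\<close>

text \<open>A gap of 3 or more between consecutive remaining numbers would put two adjacent numbers
  into \<open>S\<close>. With \<open>S\<close> the levels of the paths, \<open>L\<close> hands out
  the other levels in increasing order.\<close>

lemma enumerate_complement_of_sparse_set:
  assumes S: "S \<subseteq> {..<N}" and sparse: "\<And>i. i \<in> S \<Longrightarrow> Suc i \<notin> S"
  obtains L where "bij_betw L {..<N - card S} ({..<N} - S)"
    "\<And>i j. i < j \<Longrightarrow> j < N - card S \<Longrightarrow> L i < L j"
    "\<And>i. Suc i < N - card S \<Longrightarrow> L (Suc i) \<le> L i + 2"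
proof -
  define xs where "xs = sorted_list_of_set ({..<N} - S)"
  have set: "set xs = {..<N} - S" "distinct xs" "sorted_wrt (<) xs"
    by (auto simp: xs_def)
  have "finite S" using S finite_subset by blast
  then have len: "length xs = N - card S"
    using S by (simp add: xs_def card_Diff_subset)
  have mono: "xs ! i < xs ! j" if "i < j" "j < length xs" for i j
    using set(3) that by (simp add: sorted_wrt_nth_less)
  have gap: "xs ! Suc i \<le> xs ! i + 2" if i: "Suc i < length xs" for i
  proof (rule ccontr)
    assume neg: "\<not> ?thesis"
    have "xs ! Suc i < N" using nth_mem[OF i] set by auto
    moreover have "d \<notin> set xs" if "xs ! i < d" "d < xs ! Suc i" for d
    proof
      assume "d \<in> set xs"
      then obtain j where j: "j < length xs" "d = xs ! j" by (metis in_set_conv_nth)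
      consider "j < i" | "j = i" | "j = Suc i" | "j > Suc i" by linarith
      then show False
        using j that mono[of j i] mono[of "Suc i" j] i by cases auto
    qed
    ultimately have "xs ! i + 1 \<in> S" "xs ! i + 2 \<in> S" using neg set by auto
    with sparse show False by fastforce
  qed
  show ?thesis
    using bij_betw_nth[OF set(2), of "{..<N - card S}" "{..<N} - S"] set mono gap len
    by (intro that[of "nth xs"]) auto
qed

text \<open>Sorting by \<open>\<phi>\<close> breaks ties arbitrarily, so that \<open>r\<close> is a
  bijection while \<open>\<phi>\<close> is only weakly increasing along it.\<close>

lemma exists_ranking:
  fixes \<phi> :: "'b \<Rightarrow> int"
  assumes "finite Y"
  obtains r where "bij_betw r Y {..<card Y}"
    "\<And>y y'. y \<in> Y \<Longrightarrow> y' \<in> Y \<Longrightarrow> r y < r y' \<Longrightarrow> \<phi> y \<le> \<phi> y'"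
proof -
  obtain xs where xs: "set xs = Y" "distinct xs" using finite_distinct_list[OF assms] by blast
  define ys where "ys = sort_key \<phi> xs"
  have ys: "set ys = Y" "distinct ys" "length ys = card Y" "sorted (map \<phi> ys)"
    using xs distinct_card[OF xs(2)] by (auto simp: ys_def)
  have bij: "bij_betw (nth ys) {..<card Y} Y"
    using ys by (intro bij_betw_nth) auto
  define r where "r = inv_into {..<card Y} (nth ys)"
  have r: "bij_betw r Y {..<card Y}" unfolding r_def by (rule bij_betw_inv_into[OF bij])
  have nth_r: "ys ! r y = y" "r y < card Y" if "y \<in> Y" for y
    using that bij r by (auto simp: r_def bij_betw_def f_inv_into_f)
  show ?thesis
  proof (rule that[OF r])
    fix y y' assume y: "y \<in> Y" "y' \<in> Y" "r y < r y'"
    then have "map \<phi> ys ! r y \<le> map \<phi> ys ! r y'"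
      using ys nth_r by (intro sorted_nth_mono) auto
    then show "\<phi> y \<le> \<phi> y'" using y nth_r ys by simp
  qed
qed

section \<open>Distinct sums on the smaller side\<close>

lemma card_le_1_if_inj:
  assumes "inj_on f A" "finite A"
  shows "card {p \<in> A. f p = d} \<le> 1"
proof -
  have "\<forall>x\<in>{p \<in> A. f p = d}. \<forall>y\<in>{p \<in> A. f p = d}. x = y"
    using assms by (auto dest: inj_onD)
  then show ?thesis using assms by (subst card_le_Suc0_iff_eq[folded One_nat_def]) auto
qed

lemma card_UN_le_mult:
  assumes "finite I" "\<And>i. i \<in> I \<Longrightarrow> card (A i) \<le> k"
  shows "card (\<Union>i\<in>I. A i) \<le> k * card I"
proof -
  have "card (\<Union>i\<in>I. A i) \<le> (\<Sum>i\<in>I. card (A i))" by (rule card_UN_le[OF assms(1)])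
  also have "\<dots> \<le> card I * k" using sum_bounded_above[of I "\<lambda>i. card (A i)" k] assms(2) by simp
  finally show ?thesis by (simp add: mult.commute)
qed

text \<open>There are \<open>2 N\<close> choices for an edge pair: a level and the end that receives the smaller label.
  Each earlier pair rules out at most 6 of them (the same or an adjacent level), and each vertex other
  than the two ends at most 2.\<close>

lemma greedy_sparse_levels:
  fixes u v :: "'o \<Rightarrow> 'a" and \<phi> :: "'a \<Rightarrow> int" and C A :: int and N :: nat
  defines "val \<equiv> \<lambda>L b. if b then A + int L else C - (A + int L)"
  assumes "finite X" "finite B"
    and "\<And>p. p \<in> B \<Longrightarrow> u p \<in> X \<and> v p \<in> X \<and> u p \<noteq> v p"
    and "6 * card B + 2 * card X \<le> 2 * N"
    and C: "2 * A + 2 * int N \<le> C + 1"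
  shows "\<exists>lev b. (\<forall>p\<in>B. lev p < N) \<and>
    (\<forall>p\<in>B. \<forall>q\<in>B. p \<noteq> q \<longrightarrow> \<bar>int (lev p) - int (lev q)\<bar> \<ge> 2) \<and>
    inj_on (\<lambda>x. \<phi> x + (\<Sum>p\<in>B. of_bool (u p = x) * val (lev p) (b p)
                           + of_bool (v p = x) * val (lev p) (\<not> b p))) (u ` B \<union> v ` B)"
  using assms(3,4,5)
proof (induction B rule: finite_induct)
  case empty
  then show ?case by simp
next
  case (insert p B)
  define S where "S lev b x = \<phi> x + (\<Sum>p\<in>B. of_bool (u p = x) * val (lev p) (b p)
                           + of_bool (v p = x) * val (lev p) (\<not> b p))" for lev b x
  have "\<exists>lev b. (\<forall>p\<in>B. lev p < N) \<and>
      (\<forall>p\<in>B. \<forall>q\<in>B. p \<noteq> q \<longrightarrow> \<bar>int (lev p) - int (lev q)\<bar> \<ge> 2) \<and>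
      inj_on (S lev b) (u ` B \<union> v ` B)"
    unfolding S_def[abs_def] using insert.prems insert.hyps by (intro insert.IH) auto
  then obtain lev b where lev: "\<And>p. p \<in> B \<Longrightarrow> lev p < N"
    "\<And>p q. p \<in> B \<Longrightarrow> q \<in> B \<Longrightarrow> p \<noteq> q \<Longrightarrow> \<bar>int (lev p) - int (lev q)\<bar> \<ge> 2"
    and inj: "inj_on (S lev b) (u ` B \<union> v ` B)"
    by blast
  let ?u = "u p" and ?v = "v p" and ?s = "S lev b"
  have uv: "?u \<in> X" "?v \<in> X" "?u \<noteq> ?v" using insert.prems by auto
  have val_neg: "val L (\<not> c) = C - val L c" for L c by (simp add: val_def)
  define Opt where "Opt = {..<N} \<times> (UNIV :: bool set)"
  have finO: "finite Opt" and cardO: "card Opt = 2 * N"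
    by (simp_all add: Opt_def card_cartesian_product)
  \<comment> \<open>The hypothesis on \<open>C\<close> puts the largest low value
    \<open>A + N - 1\<close> below the smallest high value \<open>C - (A + N - 1)\<close>, so
    distinct options have distinct values.\<close>
  have val_inj: "inj_on (\<lambda>(L, c). val L c) Opt"
    using C by (auto simp: inj_on_def Opt_def val_def split: if_splits)
  \<comment> \<open>The forbidden options: \<open>near q\<close> is too close to the level of
    \<open>q\<close>, \<open>hit z\<close> gives one of the two ends the sum at \<open>z\<close>,
    and \<open>self\<close> gives both ends the same sum.\<close>
  define near where "near q = {l \<in> Opt. \<bar>int (fst l) - int (lev q)\<bar> < 2}" for q
  define hit where "hit z = {l \<in> Opt. (case l of (L, c) \<Rightarrow> val L c) = ?s z - ?s ?u} \<union>
      {l \<in> Opt. (case l of (L, c) \<Rightarrow> val L c) = C + ?s ?v - ?s z}" for z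
  define self where "self = {l \<in> Opt. (case l of (L, c) \<Rightarrow> 2 * val L c) = C + ?s ?v - ?s ?u}"
  have "card (near q) \<le> 6" for q
  proof -
    have "near q \<subseteq> {lev q - 1, lev q, lev q + 1} \<times> UNIV" by (auto simp: near_def)
    then have "card (near q) \<le> card ({lev q - 1, lev q, lev q + 1} \<times> (UNIV :: bool set))"
      by (intro card_mono) auto
    also have "\<dots> = card {lev q - 1, lev q, lev q + 1} * 2" by (simp only: card_cartesian_product card_UNIV_bool)
    also have "\<dots> \<le> 3 * 2"
      by (intro mult_right_mono) (auto simp: card_insert_if)
    finally show ?thesis by simp
  qed
  then have 1: "card (\<Union>q\<in>B. near q) \<le> 6 * card B"
    using insert.hyps(1) by (intro card_UN_le_mult)
  have "card (hit z) \<le> 1 + 1" for z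
    unfolding hit_def
    by (intro order_trans[OF card_Un_le] add_mono card_le_1_if_inj val_inj finO)
  then have 2: "card (\<Union>z\<in>X - {?u, ?v}. hit z) \<le> 2 * card (X - {?u, ?v})"
    using assms(2) by (intro card_UN_le_mult) (simp_all add: numeral_2_eq_2)
  have "inj_on (\<lambda>(L, c). 2 * val L c) Opt"
    using val_inj unfolding inj_on_def by (simp add: split_beta)
  then have 3: "card self \<le> 1" unfolding self_def using finO by (intro card_le_1_if_inj) auto
  have "card {?u, ?v} \<le> card X" using uv assms(2) by (intro card_mono) auto
  then have "card (X - {?u, ?v}) + 2 = card X"
    using uv assms(2) by (subst card_Diff_subset) auto
  define Bad where "Bad = (\<Union>q\<in>B. near q) \<union> (\<Union>z\<in>X - {?u, ?v}. hit z) \<union> self"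
  \<comment> \<open>This is \<open>6 * card B + 2 * card X - 3\<close>, whereas the hypothesis for
    \<open>insert p B\<close> provides at least \<open>6 * card B + 6 + 2 * card X\<close>
    options.\<close>
  have "card Bad \<le> 6 * card B + 2 * card (X - {?u, ?v}) + 1"
    unfolding Bad_def by (intro order_trans[OF card_Un_le] add_mono 1 2 3)
  also have "\<dots> < card Opt"
    using \<open>card (X - {?u, ?v}) + 2 = card X\<close> insert.prems(2) insert.hyps cardO by simp
  finally have "card Bad < card Opt" .
  moreover have "Bad \<subseteq> Opt" by (auto simp: Bad_def near_def hit_def self_def)
  ultimately have "\<not> Opt \<subseteq> Bad" by auto
  then obtain L c where Lc: "(L, c) \<in> Opt" and bad: "(L, c) \<notin> Bad" by auto
  then have free: "(L, c) \<notin> (\<Union>q\<in>B. near q)" "(L, c) \<notin> (\<Union>z\<in>X - {?u, ?v}. hit z)" "(L, c) \<notin> self"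
    by (simp_all add: Bad_def)
  define lev' where "lev' = lev(p := L)"
  define b' where "b' = b(p := c)"
  define s' where "s' x = \<phi> x + (\<Sum>p\<in>insert p B. of_bool (u p = x) * val (lev' p) (b' p)
                           + of_bool (v p = x) * val (lev' p) (\<not> b' p))" for x
  have "(\<Sum>q\<in>B. of_bool (u q = x) * val (lev' q) (b' q) + of_bool (v q = x) * val (lev' q) (\<not> b' q)) =
      (\<Sum>q\<in>B. of_bool (u q = x) * val (lev q) (b q) + of_bool (v q = x) * val (lev q) (\<not> b q))" for x
    using insert.hyps by (intro sum.cong) (auto simp: lev'_def b'_def)
  then have s': "s' x = ?s x + of_bool (?u = x) * val L c + of_bool (?v = x) * (C - val L c)" for x
    using insert.hyps by (simp add: s'_def S_def lev'_def b'_def val_neg)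
  have su: "s' ?u = ?s ?u + val L c" "s' ?v = ?s ?v + C - val L c"
    and sz: "z \<noteq> ?u \<Longrightarrow> z \<noteq> ?v \<Longrightarrow> s' z = ?s z" for z
    using uv by (auto simp: s')
  have no_hit: "s' ?u \<noteq> s' z" "s' ?v \<noteq> s' z" if "z \<in> X" "z \<noteq> ?u" "z \<noteq> ?v" for z
  proof -
    have "(L, c) \<notin> hit z" using free(2) that by auto
    then show "s' ?u \<noteq> s' z" "s' ?v \<noteq> s' z" using that Lc by (auto simp: hit_def su sz)
  qed
  have no_self: "s' ?u \<noteq> s' ?v"
    using free(3) Lc by (auto simp: self_def su)
  have "inj_on s' (u ` insert p B \<union> v ` insert p B)"
  proof (rule inj_onI)
    fix x y assume xy: "x \<in> u ` insert p B \<union> v ` insert p B" "y \<in> u ` insert p B \<union> v ` insert p B" "s' x = s' y"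
    then have "x \<in> X" "y \<in> X" using insert.prems by auto
    consider "x = ?u \<or> x = ?v" | "y = ?u \<or> y = ?v" | "x \<notin> {?u, ?v}" "y \<notin> {?u, ?v}" by blast
    then show "x = y"
    proof cases
      case 1
      then show ?thesis using no_hit[of y] no_self xy \<open>y \<in> X\<close> by metis
    next
      case 2
      then show ?thesis using no_hit[of x] no_self xy \<open>x \<in> X\<close> by metis
    next
      case 3
      then show ?thesis using inj xy sz by (auto dest!: inj_onD)
    qed
  qed
  moreover have "\<forall>q\<in>insert p B. lev' q < N" using lev Lc by (auto simp: lev'_def Opt_def)
  moreover have "\<forall>q\<in>insert p B. \<forall>r\<in>insert p B. q \<noteq> r \<longrightarrow> \<bar>int (lev' q) - int (lev' r)\<bar> \<ge> 2"
    using lev(2) free(1) Lc insert.hyps by (auto simp: lev'_def near_def)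
  ultimately show ?case
    unfolding s'_def[abs_def] by blast
qed

text \<open>Take a maximum family of such paths in \<open>H\<close> with disjoint ends. The vertices left over have pairwise
  disjoint neighbourhoods, so there are few of them, and each can be joined to another vertex through
  the spare edge \<open>s y\<close> of a neighbour \<open>y\<close> of its own.\<close>

lemma covering_cherries:
  fixes H Q :: "('a \<times> 'b) set"
  assumes "finite X" "finite Y" "H \<subseteq> X \<times> Y" "H \<inter> Q = {}"
    and deg: "\<And>x. x \<in> X \<Longrightarrow> card {e \<in> H. fst e = x} \<ge> d" and "d > 0"
    and s: "\<And>y. y \<in> Y \<Longrightarrow> s y \<in> Q \<and> snd (s y) = y"
  obtains P Sp where "finite P" "Sp \<subseteq> Y" "d * card Sp \<le> card Y" "2 * card P = card X + card Sp"
    "inj_on fst P" "inj_on snd P" "fst ` P \<inter> snd ` P = {}" "fst ` P \<subseteq> H" "snd ` P \<subseteq> H \<union> s ` Sp"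
    "\<forall>q\<in>P. snd (snd q) = snd (fst q) \<and> fst (snd q) \<noteq> fst (fst q)"
    "X \<subseteq> (fst \<circ> fst) ` P \<union> (fst \<circ> snd) ` P"
proof -
  define ends where "ends q = {fst (fst q), fst (snd q)}" for q :: "('a \<times> 'b) \<times> ('a \<times> 'b)"
  \<comment> \<open>Only the ends of the paths must be disjoint; several paths may share a middle
    vertex.\<close>
  define good where "good P \<longleftrightarrow> P \<subseteq> H \<times> H \<and> (\<forall>q\<in>P. snd (snd q) = snd (fst q) \<and> fst (snd q) \<noteq> fst (fst q)) \<and>
      (\<forall>q\<in>P. \<forall>r\<in>P. q \<noteq> r \<longrightarrow> ends q \<inter> ends r = {})" for P
  have finH: "finite H" using assms by (meson finite_SigmaI finite_subset)
  then have fin_good: "finite {P. good P}"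
    by (intro finite_subset[of "{P. good P}" "Pow (H \<times> H)"]) (auto simp: good_def)
  have "good {}" by (simp add: good_def)
  then have "Max (card ` {P. good P}) \<in> card ` {P. good P}"
    using fin_good by (intro Max_in) auto
  then obtain P where P: "good P" and "card P = Max (card ` {P. good P})" by auto
  then have max: "card P' \<le> card P" if "good P'" for P'
    using fin_good that by simp
  have finP: "finite P" using P finH by (auto simp: good_def intro: finite_subset)
  define E where "E = \<Union> (ends ` P)"
  define U where "U = X - E"
  have EX: "E \<subseteq> X" using P assms(3) unfolding E_def ends_def good_def by fastforce
  have "card E = (\<Sum>q\<in>P. card (ends q))"
    unfolding E_def using P finP by (intro card_UN_disjoint) (auto simp: good_def ends_def)
  also have "\<dots> = (\<Sum>q\<in>P. 2)" using P by (intro sum.cong) (auto simp: good_def ends_def card_insert_if)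
  finally have cardE: "card E = 2 * card P" by simp
  have finU: "finite U" using assms by (simp add: U_def)
  have cardX: "card X = 2 * card P + card U"
    using card_Diff_subset[of E X] card_mono[OF assms(1) EX] EX assms(1) finite_subset
    unfolding U_def cardE by fastforce
  define N where "N u = snd ` {e \<in> H. fst e = u}" for u
  have N: "N u \<subseteq> Y" for u using assms by (auto simp: N_def)
  have cardN: "card (N u) = card {e \<in> H. fst e = u}" for u
    unfolding N_def by (intro card_image inj_onI) (auto simp: prod_eq_iff)
  \<comment> \<open>A common neighbour of two uncovered vertices would be the middle of a further
    path, contradicting the maximality of \<open>P\<close>.\<close>
  have disj: "N u \<inter> N v = {}" if "u \<in> U" "v \<in> U" "u \<noteq> v" for u v
  proof (rule ccontr)
    assume "N u \<inter> N v \<noteq> {}"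
    then obtain y where y: "(u, y) \<in> H" "(v, y) \<in> H" by (auto simp: N_def)
    let ?q = "((u, y), (v, y))"
    have no_end: "u \<notin> ends r \<and> v \<notin> ends r" if "r \<in> P" for r
      using that \<open>u \<in> U\<close> \<open>v \<in> U\<close> by (auto simp: U_def E_def)
    have "?q \<notin> P" using no_end[of ?q] by (auto simp: ends_def)
    moreover have "good (insert ?q P)"
      using P y that no_end by (auto simp: good_def ends_def)
    ultimately show False using max[of "insert ?q P"] finP by simp
  qed
  have "d * card U \<le> (\<Sum>u\<in>U. card (N u))"
    using sum_bounded_below[of U d "\<lambda>u. card (N u)"] deg by (simp add: cardN U_def mult.commute)
  also have "\<dots> = card (\<Union> (N ` U))"
    using finU disj finite_subset[OF N assms(2)] by (intro card_UN_disjoint[symmetric]) auto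
  also have "\<dots> \<le> card Y" using N assms(2) by (intro card_mono) auto
  finally have dU: "d * card U \<le> card Y" .
  have "\<exists>y. (u, y) \<in> H" if "u \<in> U" for u
  proof -
    have "card {e \<in> H. fst e = u} > 0" using deg[of u] that \<open>d > 0\<close> by (simp add: U_def)
    then have "{e \<in> H. fst e = u} \<noteq> {}" by (metis card.empty less_numeral_extra(3))
    then show ?thesis by force
  qed
  then obtain c where c: "\<And>u. u \<in> U \<Longrightarrow> (u, c u) \<in> H" by metis
  have c_inj: "inj_on c U"
  proof (rule inj_onI, rule ccontr)
    fix u v assume "u \<in> U" "v \<in> U" "c u = c v" "u \<noteq> v"
    moreover have "c u \<in> N u" "c v \<in> N v" using c calculation by (force simp: N_def)+
    ultimately show False using disj[of u v] by auto
  qed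
  have cY: "c u \<in> Y" if "u \<in> U" for u using c[OF that] assms(3) by auto
  \<comment> \<open>The path from \<open>u\<close> through \<open>c u\<close> ends wherever the
    spare edge of \<open>c u\<close> leads. That end may be covered already: only the edges have to
    be new, and each of these paths adds 1 to the excess of \<open>2 * card P\<close> over
    \<open>card X\<close>.\<close>
  define R where "R = (\<lambda>u. ((u, c u), s (c u))) ` U"
  have R_inj: "inj_on (\<lambda>u. ((u, c u), s (c u))) U" by (auto intro: inj_onI)
  have PR: "P \<inter> R = {}"
  proof -
    have "fst (fst q) \<in> E" if "q \<in> P" for q using that by (auto simp: E_def ends_def)
    then show ?thesis by (force simp: R_def U_def)
  qed
  have P_E: "fst (fst q) \<in> E" "fst (snd q) \<in> E" "fst q \<in> H" "snd q \<in> H" if "q \<in> P" for q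
    using that P by (auto simp: E_def ends_def good_def)
  have P_eq: "q = r" if "q \<in> P" "r \<in> P" "ends q \<inter> ends r \<noteq> {}" for q r
    using that P unfolding good_def by blast
  have R_E: "fst (fst q) \<in> U" "fst q = (fst (fst q), c (fst (fst q)))" "snd q = s (c (fst (fst q)))"
    "fst q \<in> H" "snd q \<in> Q" "snd (snd q) = snd (fst q)" if "q \<in> R" for q
    using that c cY s by (auto simp: R_def)
  have HQ: "e \<in> H \<Longrightarrow> e \<in> Q \<Longrightarrow> False" for e using assms(4) by auto
  have UE: "x \<in> U \<Longrightarrow> x \<in> E \<Longrightarrow> False" for x by (simp add: U_def)
  show ?thesis
  proof (rule that[of "P \<union> R" "c ` U"])
    show "finite (P \<union> R)" using finP finU by (simp add: R_def)
    show "c ` U \<subseteq> Y" using cY by auto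
    show "d * card (c ` U) \<le> card Y" using dU card_image[OF c_inj] by simp
    have "card (P \<union> R) = card P + card U"
      using finP finU PR card_image[OF R_inj] by (subst card_Un_disjoint) (auto simp: R_def)
    then show "2 * card (P \<union> R) = card X + card (c ` U)"
      using cardX card_image[OF c_inj] by simp
    show "inj_on fst (P \<union> R)"
    proof (rule inj_onI)
      fix q r assume qr: "q \<in> P \<union> R" "r \<in> P \<union> R" "fst q = fst r"
      then consider "q \<in> P" "r \<in> P" | "q \<in> P" "r \<in> R" | "q \<in> R" "r \<in> P" | "q \<in> R" "r \<in> R" by blast
      then show "q = r"
      proof cases
        case 1
        then show ?thesis using qr by (intro P_eq) (auto simp: ends_def)
      next
        case 2
        then show ?thesis using P_E(1)[of q] R_E(1)[of r] UE qr by metis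
      next
        case 3
        then show ?thesis using P_E(1)[of r] R_E(1)[of q] UE qr by metis
      next
        case 4
        then show ?thesis using R_E(3)[of q] R_E(3)[of r] qr by (simp add: prod_eq_iff)
      qed
    qed
    show "inj_on snd (P \<union> R)"
    proof (rule inj_onI)
      fix q r assume qr: "q \<in> P \<union> R" "r \<in> P \<union> R" "snd q = snd r"
      then consider "q \<in> P" "r \<in> P" | "q \<in> P" "r \<in> R" | "q \<in> R" "r \<in> P" | "q \<in> R" "r \<in> R" by blast
      then show "q = r"
      proof cases
        case 1
        then show ?thesis using qr by (intro P_eq) (auto simp: ends_def)
      next
        case 2
        then show ?thesis using P_E(4)[of q] R_E(5)[of r] HQ qr by metis
      next
        case 3
        then show ?thesis using P_E(4)[of r] R_E(5)[of q] HQ qr by metis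
      next
        case 4
        then obtain u v where uv: "u \<in> U" "v \<in> U" "q = ((u, c u), s (c u))" "r = ((v, c v), s (c v))"
          by (auto simp: R_def)
        then have "c u = c v" using s cY qr(3) by (metis snd_conv)
        then show ?thesis using uv c_inj by (auto dest: inj_onD)
      qed
    qed
    show "fst ` (P \<union> R) \<inter> snd ` (P \<union> R) = {}"
    proof (rule ccontr)
      assume "\<not> ?thesis"
      then obtain q r where qr: "q \<in> P \<union> R" "r \<in> P \<union> R" "fst q = snd r" by blast
      have "r \<in> P" using qr P_E(3)[of q] R_E(4)[of q] R_E(5)[of r] HQ by (metis UnE)
      moreover have "q \<in> P" using qr R_E(1)[of q] P_E(2)[OF \<open>r \<in> P\<close>] UE by (metis UnE)
      ultimately have "q = r" using qr by (intro P_eq) (auto simp: ends_def)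
      then show False using P \<open>q \<in> P\<close> qr by (metis good_def)
    qed
    show "fst ` (P \<union> R) \<subseteq> H" using P_E(3) R_E(4) by blast
    show "snd ` (P \<union> R) \<subseteq> H \<union> s ` (c ` U)" using P_E(4) R_E(1,3) by blast
    show "\<forall>q\<in>P \<union> R. snd (snd q) = snd (fst q) \<and> fst (snd q) \<noteq> fst (fst q)"
    proof (intro ballI)
      fix q assume q: "q \<in> P \<union> R"
      show "snd (snd q) = snd (fst q) \<and> fst (snd q) \<noteq> fst (fst q)"
      proof (cases "q \<in> P")
        case True
        then show ?thesis using P by (simp add: good_def)
      next
        case False
        then have "q \<in> R" using q by simp
        note R = R_E[OF this]
        have "fst q \<noteq> snd q" using R(4,5) HQ by metis
        then show ?thesis using R(6) by (auto simp: prod_eq_iff)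
      qed
    qed
    show "X \<subseteq> (fst \<circ> fst) ` (P \<union> R) \<union> (fst \<circ> snd) ` (P \<union> R)"
    proof
      fix x assume "x \<in> X"
      show "x \<in> (fst \<circ> fst) ` (P \<union> R) \<union> (fst \<circ> snd) ` (P \<union> R)"
      proof (cases "x \<in> U")
        case True
        then have "((x, c x), s (c x)) \<in> P \<union> R" by (simp add: R_def)
        then show ?thesis by (metis UnI1 comp_apply fst_conv image_eqI)
      next
        case False
        then have "x \<in> E" using \<open>x \<in> X\<close> by (simp add: U_def)
        then show ?thesis by (auto simp: E_def ends_def)
      qed
    qed
  qed
qed

lemma sum_over_zigzag:
  fixes g :: "'e \<Rightarrow> int"
  assumes "inj_on lo {..<K :: nat}" "inj_on hi {..<K}" "lo ` {..<K} \<inter> hi ` {..<K} = {}"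
  shows "(\<Sum>e\<in>lo ` {..<K} \<union> hi ` {..<K}. g e) = (\<Sum>i<K. g (lo i) + g (hi i))"
proof -
  have "(\<Sum>e\<in>lo ` {..<K} \<union> hi ` {..<K}. g e) = (\<Sum>e\<in>lo ` {..<K}. g e) + (\<Sum>e\<in>hi ` {..<K}. g e)"
    using assms by (intro sum.union_disjoint) auto
  also have "(\<Sum>e\<in>lo ` {..<K}. g e) = (\<Sum>i<K. g (lo i))" using assms by (simp add: sum.reindex)
  also have "(\<Sum>e\<in>hi ` {..<K}. g e) = (\<Sum>i<K. g (hi i))" using assms by (simp add: sum.reindex)
  finally show ?thesis by (simp add: sum.distrib)
qed

text \<open>The closed form of \<open>\<delta>\<close> reflects that stretching turns a step of length \<open>k\<close> into one of length
  between \<open>k\<close> and \<open>2 k\<close>.\<close>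

lemma stretched_step_bounds:
  fixes L :: "nat \<Rightarrow> nat" and i j :: nat
  defines "\<delta> \<equiv> if i \<le> j then int j - int i else 2 * (int j - int i)"
  assumes mono: "\<And>i j. i < j \<Longrightarrow> j < K \<Longrightarrow> L i < L j"
    and gap: "\<And>i. Suc i < K \<Longrightarrow> L (Suc i) \<le> L i + 2"
    and "i < K" "j < K" "\<bar>int j - int i\<bar> \<le> 2"
  shows "\<delta> \<le> int (L j) - int (L i)" "int (L j) - int (L i) \<le> \<delta> + 2"
proof -
  have one: "L i + 1 \<le> L (i + 1)" "L (i + 1) \<le> L i + 2" if "i + 1 < K" for i
    using mono[of i "i + 1"] gap[of i] that by auto
  have two: "L i + 2 \<le> L (i + 2)" "L (i + 2) \<le> L i + 4" if "i + 2 < K" for i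
    using one[of i] one[of "i + 1"] that by (auto simp: numeral_2_eq_2)
  consider "j = i" | "j = i + 1" | "j = i + 2" | "i = j + 1" | "i = j + 2"
    using assms(6) by linarith
  then have "\<delta> \<le> int (L j) - int (L i) \<and> int (L j) - int (L i) \<le> \<delta> + 2"
    using one[of i] two[of i] one[of j] two[of j] assms(4,5) by cases (auto simp: \<delta>_def)
  then show "\<delta> \<le> int (L j) - int (L i)" "int (L j) - int (L i) \<le> \<delta> + 2" by auto
qed

section \<open>Labelling the cut\<close>

text \<open>At equal cardinality, covering \<open>B\<close> forces injectivity; for the labelling it
  therefore suffices that every label occurs.\<close>

lemma bij_betw_if_covers:
  assumes "finite A" "card B = card A" "B \<subseteq> f ` A"
  shows "bij_betw f A B"
proof -
  have "card (f ` A) \<le> card A" using assms by (intro card_image_le)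
  then have "B = f ` A" using assms by (intro card_seteq) auto
  then show ?thesis using assms by (simp add: bij_betw_def eq_card_imp_inj_on)
qed

lemma inj_on_if_increasing_along:
  fixes f :: "'b \<Rightarrow> int" and r :: "'b \<Rightarrow> nat"
  assumes "inj_on r Y" "\<And>y y'. y \<in> Y \<Longrightarrow> y' \<in> Y \<Longrightarrow> r y < r y' \<Longrightarrow> f y < f y'"
  shows "inj_on f Y"
proof (rule inj_onI)
  fix y y' assume y: "y \<in> Y" "y' \<in> Y" "f y = f y'"
  then have "\<not> r y < r y'" "\<not> r y' < r y" using assms(2) by (metis less_irrefl)+
  then show "y = y'" using y assms(1) by (auto dest: inj_onD)
qed

text \<open>
  Half of the edges, the set \<open>H\<close>, carry the paths covering \<open>X\<close>. Every \<open>y\<close> keeps a set \<open>G y\<close> of 8 other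
  edges: its private edge \<open>r y\<close>, its spare edge \<open>s y\<close>, and 6 or 7 edges that may enter \<open>F\<close>.
\<close>

lemma bipartite_labeling:
  fixes X :: "'a set" and Y :: "'b set" and \<alpha> :: "'a \<Rightarrow> int" and \<beta> :: "'b \<Rightarrow> int" and M :: nat
  assumes fin: "finite X" "finite Y" and E: "E \<subseteq> X \<times> Y"
    and degX: "\<And>x. x \<in> X \<Longrightarrow> card {e \<in> E. fst e = x} \<ge> 17"
    and degY: "\<And>y. y \<in> Y \<Longrightarrow> card {e \<in> E. snd e = y} \<ge> 17"
    and XY: "card X \<le> card Y"
  obtains l :: "'a \<times> 'b \<Rightarrow> int" where "bij_betw l E {int M + 1..int M + int (card E)}"
    "inj_on (\<lambda>x. \<alpha> x + (\<Sum>e\<in>E. of_bool (fst e = x) * l e)) X"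
    "inj_on (\<lambda>y. \<beta> y + (\<Sum>e\<in>E. of_bool (snd e = y) * l e)) Y"
proof -

  \<comment> \<open>Reserving private edges, paths and the even set\<close>
  have finE: "finite E" using fin E by (meson finite_SigmaI finite_subset)
  obtain H where H: "H \<subseteq> E"
    and balX: "\<And>x. \<bar>int (card {e \<in> H. fst e = x}) - int (card {e \<in> E - H. fst e = x})\<bar> \<le> 1"
    and balY: "\<And>y. \<bar>int (card {e \<in> H. snd e = y}) - int (card {e \<in> E - H. snd e = y})\<bar> \<le> 1"
    using bipartite_balanced_halving[OF finE] by blast
  have split: "card {e \<in> E. p e} = card {e \<in> H. p e} + card {e \<in> E - H. p e}" for p
  proof -
    have "{e \<in> E. p e} = {e \<in> H. p e} \<union> {e \<in> E - H. p e}" using H by auto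
    then show ?thesis using finE finite_subset[OF H finE] by (auto intro!: card_Un_disjoint)
  qed
  \<comment> \<open>17 edges split with difference at most 1 leave at least 8 on either
    side.\<close>
  have HX: "card {e \<in> H. fst e = x} \<ge> 8" if "x \<in> X" for x
    using degX[OF that] balX[of x] split[of "\<lambda>e. fst e = x"] by linarith
  have "\<exists>G. G \<subseteq> {e \<in> E - H. snd e = y} \<and> card G = 8" if "y \<in> Y" for y
  proof -
    have "8 \<le> card {e \<in> E - H. snd e = y}"
      using degY[OF that] balY[of y] split[of "\<lambda>e. snd e = y"] by linarith
    then obtain T where "T \<subseteq> {e \<in> E - H. snd e = y}" "card T = 8"
      by (rule obtain_subset_with_card_n)
    then show ?thesis by blast
  qed
  then obtain G where G: "\<And>y. y \<in> Y \<Longrightarrow> G y \<subseteq> {e \<in> E - H. snd e = y}" "\<And>y. y \<in> Y \<Longrightarrow> card (G y) = 8"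
    by metis
  have "\<exists>r s. r \<in> G y \<and> s \<in> G y \<and> r \<noteq> s" if "y \<in> Y" for y
  proof -
    have "2 \<le> card (G y)" using G(2)[OF that] by simp
    then obtain T where "T \<subseteq> G y" "card T = 2" by (rule obtain_subset_with_card_n)
    then show ?thesis unfolding card_2_iff by blast
  qed
  then obtain r s where rs: "\<And>y. y \<in> Y \<Longrightarrow> r y \<in> G y" "\<And>y. y \<in> Y \<Longrightarrow> s y \<in> G y" "\<And>y. y \<in> Y \<Longrightarrow> r y \<noteq> s y"
    by metis
  have Gsnd: "snd e = y" "e \<in> E" "e \<notin> H" if "e \<in> G y" "y \<in> Y" for e y using G(1) that by auto
  have HXY: "H \<subseteq> X \<times> Y" using H E by auto
  have s_own: "s y \<in> E - H \<and> snd (s y) = y" if "y \<in> Y" for y using rs(2) Gsnd that by blast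
  have HQ: "H \<inter> (E - H) = {}" by blast
  obtain P Sp where P: "finite P" "Sp \<subseteq> Y" "8 * card Sp \<le> card Y" "2 * card P = card X + card Sp"
    "inj_on fst P" "inj_on snd P" "fst ` P \<inter> snd ` P = {}" "fst ` P \<subseteq> H" "snd ` P \<subseteq> H \<union> s ` Sp"
    and cherry: "\<forall>q\<in>P. snd (snd q) = snd (fst q) \<and> fst (snd q) \<noteq> fst (fst q)"
    and cover: "X \<subseteq> (fst \<circ> fst) ` P \<union> (fst \<circ> snd) ` P"
    using covering_cherries[OF fin HXY HQ HX zero_less_numeral s_own] .
  have P10: "snd (snd q) = snd (fst q)" "fst (snd q) \<noteq> fst (fst q)" if "q \<in> P" for q
    using cherry that by blast+
  define RX where "RX = fst ` P \<union> snd ` P"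
  define RY where "RY = r ` Y"
  \<comment> \<open>Candidates for \<open>F\<close>: 7 edges at each \<open>y\<close>, without the
    spare edges already spent on paths.\<close>
  define B0 where "B0 = (\<Union>y\<in>Y. G y - {r y}) - s ` Sp"
  have finG: "finite (G y)" if "y \<in> Y" for y using G(2)[OF that] card.infinite by fastforce
  have cardG: "card (G y - {r y}) = 7" if "y \<in> Y" for y
    using G(2)[OF that] rs(1)[OF that] finG[OF that] by (subst card_Diff_subset) auto
  have "card (\<Union>y\<in>Y. G y - {r y}) = (\<Sum>y\<in>Y. card (G y - {r y}))"
    using fin finG Gsnd by (intro card_UN_disjoint) blast+
  also have "\<dots> = 7 * card Y" using cardG by simp
  finally have "card (\<Union>y\<in>Y. G y - {r y}) = 7 * card Y" .
  moreover have finSp: "finite Sp" using P(2) fin finite_subset by blast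
  moreover have "card (s ` Sp) \<le> card Sp" using finSp by (rule card_image_le)
  moreover have "card (\<Union>y\<in>Y. G y - {r y}) - card (s ` Sp) \<le> card B0"
    unfolding B0_def using finSp by (intro diff_card_le_card_Diff) auto
  ultimately have cardB0: "7 * card Y \<le> card B0 + card Sp" by linarith
  have B0E: "B0 \<subseteq> E" using Gsnd by (auto simp: B0_def)
  then have B0XY: "B0 \<subseteq> X \<times> Y" using E by auto
  from large_even_subset[OF fin this]
  obtain F where F: "F \<subseteq> B0" "even_degrees F" "card B0 \<le> card F + card X + card Y" by blast
  have finF: "finite F" by (rule finite_subset[OF subset_trans[OF F(1) B0E] finE])
  obtain K lo hi \<tau> where zz: "card F = 2 * K" "inj_on lo {..<K}" "inj_on hi {..<K}"
    "lo ` {..<K} \<inter> hi ` {..<K} = {}" "lo ` {..<K} \<union> hi ` {..<K} = F"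
    and zzX': "\<forall>i<K. fst (hi i) = fst (lo i)" and \<tau>_bij: "bij_betw \<tau> {..<K} {..<K}"
    and \<tau>_snd: "\<forall>i<K. snd (lo (\<tau> i)) = snd (hi i)" and \<tau>_near: "\<forall>i<K. \<bar>int (\<tau> i) - int i\<bar> \<le> 2"
    using even_degrees_zigzag[OF finF F(2)] .
  have zzX: "fst (hi i) = fst (lo i)" if "i < K" for i using zzX' that by blast
  have \<tau>: "bij_betw \<tau> {..<K} {..<K}" "\<And>i. i < K \<Longrightarrow> snd (lo (\<tau> i)) = snd (hi i)"
    "\<And>i. i < K \<Longrightarrow> \<bar>int (\<tau> i) - int i\<bar> \<le> 2"
    using \<tau>_bij \<tau>_snd \<tau>_near by blast+
  have sumF: "(\<Sum>e\<in>F. g e) = (\<Sum>i<K. g (lo i) + g (hi i))" for g :: "'a \<times> 'b \<Rightarrow> int"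
    using sum_over_zigzag[OF zz(2-4), of g] by (simp only: zz(5))
  \<comment> \<open>\<open>hi i\<close> and \<open>lo (\<tau> i)\<close> form a passage through a
    vertex of \<open>Y\<close>; reindexing by \<open>\<tau>\<close> collects both of its edges under
    the index \<open>i\<close>.\<close>
  have loY: "(\<Sum>i<K. of_bool (snd (lo i) = y) * g i) = (\<Sum>i<K. of_bool (snd (hi i) = y) * g (\<tau> i))"
    for g :: "nat \<Rightarrow> int" and y
  proof -
    have "(\<Sum>i<K. of_bool (snd (lo i) = y) * g i) = (\<Sum>i<K. of_bool (snd (lo (\<tau> i)) = y) * g (\<tau> i))"
      by (rule sum.reindex_bij_betw[OF \<tau>(1), symmetric])
    also have "\<dots> = (\<Sum>i<K. of_bool (snd (hi i) = y) * g (\<tau> i))"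
      using \<tau>(2) by (intro sum.cong) auto
    finally show ?thesis .
  qed
  \<comment> \<open>The degree of \<open>F\<close> at \<open>y\<close> is at most 7 and even, hence
    at most 6, and each passage uses two edges.\<close>
  have passes: "(\<Sum>i<K. of_bool (snd (hi i) = y)) \<le> (3 :: int)" if "y \<in> Y" for y
  proof -
    have sub: "{e \<in> F. snd e = y} \<subseteq> G y - {r y}"
    proof
      fix e assume "e \<in> {e \<in> F. snd e = y}"
      then have "e \<in> F" "snd e = y" by auto
      then obtain y' where y': "y' \<in> Y" "e \<in> G y'" "e \<noteq> r y'" using F(1) by (auto simp: B0_def)
      then have "y' = y" using Gsnd(1)[OF y'(2,1)] \<open>snd e = y\<close> by simp
      with y' show "e \<in> G y - {r y}" by simp
    qed
    have "card {e \<in> F. snd e = y} \<le> card (G y - {r y})"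
      by (rule card_mono[OF _ sub]) (simp add: finG[OF that])
    then have "card {e \<in> F. snd e = y} \<le> 7" by (simp only: cardG[OF that])
    moreover have "even (card {e \<in> F. snd e = y})" using F(2) by (simp add: even_degrees_def)
    ultimately have "card {e \<in> F. snd e = y} \<le> 6" by presburger
    moreover have "int (card {e \<in> F. snd e = y}) = (\<Sum>e\<in>F. of_bool (snd e = y))"
      using finF by (simp add: sum_of_bool_eq Int_def)
    moreover have "\<dots> = 2 * (\<Sum>i<K. of_bool (snd (hi i) = y))"
      using loY[of y "\<lambda>_. 1"] by (simp add: sumF sum.distrib)
    ultimately show ?thesis by linarith
  qed

  \<comment> \<open>Counting levels and labels\<close>
  define N where "N = K + card P"
  \<comment> \<open>Write x, y, p, s for the sizes of \<open>X\<close>, \<open>Y\<close>,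
    \<open>P\<close>, \<open>Sp\<close>. Since 2K \<ge> 6y - s - x and 2p = x + s, the first claim
    reduces to 5x + 3s \<le> 6y, which follows from x \<le> y and 8s \<le> y. For the second, 2K
    \<le> 6y by \<open>passes\<close> and 2p \<le> 2y.\<close>
  have sizes: "6 * card P + 2 * card X \<le> 2 * N" "2 * N + 7 * card Y \<le> 17 * card Y"
  proof -
    have Sp: "3 * card Sp \<le> card Y" "card Sp \<le> card Y" using P(3) by simp_all
    then show "6 * card P + 2 * card X \<le> 2 * N"
      using cardB0 F(3) zz(1) P(3,4) XY unfolding N_def add_mult_distrib2 by linarith
    have "2 * int K = (\<Sum>e\<in>F. 1)" using zz(1) by simp
    also have "\<dots> = (\<Sum>e\<in>F. \<Sum>y\<in>Y. of_bool (snd e = y))"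
    proof (intro sum.cong refl)
      fix e assume "e \<in> F"
      then have "snd e \<in> Y" using F(1) B0XY by auto
      then show "1 = (\<Sum>y\<in>Y. of_bool (snd e = y) :: int)"
        using fin by (simp add: of_bool_def)
    qed
    also have "\<dots> = (\<Sum>y\<in>Y. \<Sum>e\<in>F. of_bool (snd e = y))" by (rule sum.swap)
    also have "\<dots> = (\<Sum>y\<in>Y. 2 * (\<Sum>i<K. of_bool (snd (hi i) = y)))"
      using loY[of _ "\<lambda>_. 1"] by (intro sum.cong) (auto simp add: sumF sum.distrib)
    also have "\<dots> \<le> (\<Sum>y\<in>Y. 2 * 3)" by (intro sum_mono mult_left_mono passes) auto
    finally have "2 * int K \<le> 6 * int (card Y)" by simp
    then show "2 * N + 7 * card Y \<le> 17 * card Y"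
      using Sp P(4) XY unfolding N_def add_mult_distrib2 by linarith
  qed
  have "17 * card Y \<le> card E"
  proof -
    have "17 * card Y \<le> (\<Sum>y\<in>Y. card {e \<in> E. snd e = y})"
      using sum_bounded_below[of Y 17 "\<lambda>y. card {e \<in> E. snd e = y}"] degY by (simp add: mult.commute)
    also have "\<dots> = card (\<Union>y\<in>Y. {e \<in> E. snd e = y})"
      using fin finE by (intro card_UN_disjoint[symmetric]) auto
    also have "\<dots> \<le> card E" using finE by (intro card_mono) auto
    finally show ?thesis .
  qed
  with sizes(2) have room: "2 * N + 7 * card Y \<le> card E" by linarith

  \<comment> \<open>Disjointness of the reserved sets\<close>
  have RX_sub: "RX \<subseteq> H \<union> s ` Sp" using P(8,9) by (auto simp: RX_def)
  have RX_E: "RX \<subseteq> E" using RX_sub H rs(2) Gsnd P(2) by blast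
  have RY_E: "RY \<subseteq> E" using rs(1) Gsnd(2) unfolding RY_def by blast
  have F_E: "F \<subseteq> E" using F B0E by blast
  have RX_RY: "RX \<inter> RY = {}"
  proof (rule ccontr)
    assume "RX \<inter> RY \<noteq> {}"
    then obtain y where y: "y \<in> Y" "r y \<in> RX" by (auto simp: RY_def)
    then have "r y \<in> s ` Sp" using RX_sub Gsnd(3)[OF rs(1)] by blast
    then obtain y' where y': "y' \<in> Sp" "r y = s y'" by auto
    then have "y' \<in> Y" using P(2) by auto
    then have "y = y'" using Gsnd(1)[OF rs(1)[OF y(1)] y(1)] Gsnd(1)[OF rs(2)] y' by metis
    then show False using rs(3) y' y by metis
  qed
  have F_RX: "F \<inter> RX = {}"
  proof -
    have "e \<notin> H \<union> s ` Sp" if "e \<in> F" for e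
      using that F(1) Gsnd(3) unfolding B0_def by blast
    then show ?thesis using RX_sub by blast
  qed
  have F_RY: "F \<inter> RY = {}"
  proof (rule ccontr)
    assume "F \<inter> RY \<noteq> {}"
    then obtain y where y: "y \<in> Y" "r y \<in> F" by (auto simp: RY_def)
    then obtain y' where y': "y' \<in> Y" "r y \<in> G y'" "r y \<noteq> r y'" using F(1) by (auto simp: B0_def)
    then have "y = y'" using Gsnd(1)[OF rs(1)[OF y(1)] y(1)] Gsnd(1) by metis
    then show False using y' by simp
  qed
  have r_inj: "inj_on r Y"
    using Gsnd(1)[OF rs(1)] by (metis inj_onI)
  have cardRX: "card RX = 2 * card P"
    using P(1,5,6,7) by (simp add: RX_def card_Un_disjoint card_image)
  have cardRY: "card RY = card Y" using r_inj by (simp add: RY_def card_image)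
  \<comment> \<open>The edges outside all reserved sets; their labels \<open>\<mu>\<close> are fixed
    before any level is chosen.\<close>
  define St where "St = E - F - RX - RY"
  have finR: "finite RX" "finite RY" "finite St"
    using RX_E RY_E finE finite_subset by (auto simp: St_def)
  have sumE: "(\<Sum>e\<in>E. g e) = (\<Sum>e\<in>St. g e) + (\<Sum>e\<in>F. g e) + (\<Sum>e\<in>RX. g e) + (\<Sum>e\<in>RY. g e)"
    for g :: "'a \<times> 'b \<Rightarrow> int"
  proof -
    have "E = ((St \<union> F) \<union> RX) \<union> RY" using F_E RX_E RY_E by (auto simp: St_def)
    moreover have "(\<Sum>e\<in>((St \<union> F) \<union> RX) \<union> RY. g e) = (\<Sum>e\<in>(St \<union> F) \<union> RX. g e) + (\<Sum>e\<in>RY. g e)"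
      using finR finF RX_RY F_RY by (intro sum.union_disjoint) (auto simp: St_def)
    moreover have "(\<Sum>e\<in>(St \<union> F) \<union> RX. g e) = (\<Sum>e\<in>St \<union> F. g e) + (\<Sum>e\<in>RX. g e)"
      using finR finF F_RX by (intro sum.union_disjoint) (auto simp: St_def)
    moreover have "(\<Sum>e\<in>St \<union> F. g e) = (\<Sum>e\<in>St. g e) + (\<Sum>e\<in>F. g e)"
      using finR finF by (intro sum.union_disjoint) (auto simp: St_def)
    ultimately show ?thesis by simp
  qed
  have "int (card E) = int (card St) + int (card F) + int (card RX) + int (card RY)"
    using sumE[of "\<lambda>_. 1"] by simp
  then have cardSt: "card E = card St + 2 * N + card Y"
    using zz(1) cardRX cardRY by (simp add: N_def)

  \<comment> \<open>Distributing the labels\<close>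
  define A where "A = int M + 1"
  \<comment> \<open>For \<open>j < N\<close>, the values \<open>A + j\<close> and
    \<open>C - (A + j)\<close> run through the lower and the upper half of the \<open>2 * N\<close>
    labels in \<open>Reg\<close>.\<close>
  define C where "C = 2 * int M + 2 * int N + 1"
  define Lab where "Lab = {int M + 1..int M + int (card E)}"
  define Reg where "Reg = {int M + 1..int M + 2 * int N}"
  \<comment> \<open>The private labels start just above \<open>Reg\<close>; by \<open>room\<close>
    all \<open>card Y\<close> of them fit into \<open>Lab\<close>.\<close>
  define priv where "priv k = int M + 2 * int N + 1 + 7 * int k" for k :: nat
  define T where "T = priv ` {..<card Y}"
  have T: "T \<subseteq> Lab" "Reg \<subseteq> Lab" "Reg \<inter> T = {}" "card T = card Y" "card Reg = 2 * N" "card Lab = card E"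
    using room by (auto simp: T_def Lab_def Reg_def priv_def card_image inj_on_def)
  have "card (Lab - Reg - T) = card St"
  proof -
    have "card (Reg \<union> T) = 2 * N + card Y"
      using T by (subst card_Un_disjoint) (auto simp: T_def Reg_def)
    moreover have "card (Lab - (Reg \<union> T)) = card Lab - card (Reg \<union> T)"
      using T by (intro card_Diff_subset) (auto simp: T_def Reg_def)
    ultimately show ?thesis using T cardSt by (simp add: Diff_Un Diff_Int_distrib set_diff_eq conj_ac)
  qed
  then obtain \<mu> where \<mu>: "bij_betw \<mu> St (Lab - Reg - T)"
    using finite_same_card_bij[of St "Lab - Reg - T"] finR by (auto simp: Lab_def)

  define \<delta> where "\<delta> i = (if i \<le> \<tau> i then int (\<tau> i) - int i else 2 * (int (\<tau> i) - int i))" for i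
  \<comment> \<open>The sum at \<open>y\<close> without its private label, as far as it is known
    before the levels: each path through \<open>y\<close> gives \<open>C\<close>, and each passage
    of \<open>F\<close> is entered with the lower bound \<open>\<delta> i\<close> for its final
    displacement.\<close>
  define \<phi>Y where "\<phi>Y y = \<beta> y + (\<Sum>e\<in>St. of_bool (snd e = y) * \<mu> e) + (\<Sum>q\<in>P. of_bool (snd (fst q) = y) * C)
      + (\<Sum>i<K. of_bool (snd (hi i) = y) * (C + \<delta> i))" for y
  obtain rk where rk: "bij_betw rk Y {..<card Y}"
    "\<And>y y'. y \<in> Y \<Longrightarrow> y' \<in> Y \<Longrightarrow> rk y < rk y' \<Longrightarrow> \<phi>Y y \<le> \<phi>Y y'"
    using exists_ranking[OF fin(2), of \<phi>Y] by blast
  \<comment> \<open>The ranking does not depend on the levels, so the private labels count as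
    constants here; each index \<open>i\<close> contributes \<open>C\<close> at the common end of
    \<open>lo i\<close> and \<open>hi i\<close>.\<close>
  define \<phi>X where "\<phi>X x = \<alpha> x + (\<Sum>e\<in>St. of_bool (fst e = x) * \<mu> e) + (\<Sum>i<K. of_bool (fst (lo i) = x) * C)
      + (\<Sum>y\<in>Y. of_bool (fst (r y) = x) * priv (rk y))" for x

  \<comment> \<open>Levels for the paths and for the even set\<close>
  let ?val = "\<lambda>L b. if b then A + int L else C - (A + int L)"
  have "\<exists>lev b. (\<forall>p\<in>P. lev p < N) \<and> (\<forall>p\<in>P. \<forall>q\<in>P. p \<noteq> q \<longrightarrow> \<bar>int (lev p) - int (lev q)\<bar> \<ge> 2) \<and>
    inj_on (\<lambda>x. \<phi>X x + (\<Sum>p\<in>P. of_bool ((fst \<circ> fst) p = x) * ?val (lev p) (b p)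
                           + of_bool ((fst \<circ> snd) p = x) * ?val (lev p) (\<not> b p))) ((fst \<circ> fst) ` P \<union> (fst \<circ> snd) ` P)"
  proof (rule greedy_sparse_levels[OF fin(1) P(1)])
    show "(fst \<circ> fst) p \<in> X \<and> (fst \<circ> snd) p \<in> X \<and> (fst \<circ> fst) p \<noteq> (fst \<circ> snd) p" if "p \<in> P" for p
    proof -
      have "fst p \<in> E" "snd p \<in> E" using RX_E that by (auto simp: RX_def)
      then show ?thesis using E P10(2)[OF that] by fastforce
    qed
  qed (use sizes in \<open>auto simp: A_def C_def\<close>)
  then obtain lev b where lev: "\<And>p. p \<in> P \<Longrightarrow> lev p < N"
    "\<And>p q. p \<in> P \<Longrightarrow> q \<in> P \<Longrightarrow> p \<noteq> q \<Longrightarrow> \<bar>int (lev p) - int (lev q)\<bar> \<ge> 2"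
    and injX: "inj_on (\<lambda>x. \<phi>X x + (\<Sum>p\<in>P. of_bool ((fst \<circ> fst) p = x) * ?val (lev p) (b p)
                           + of_bool ((fst \<circ> snd) p = x) * ?val (lev p) (\<not> b p))) ((fst \<circ> fst) ` P \<union> (fst \<circ> snd) ` P)"
    by blast
  have lev_inj: "inj_on lev P"
  proof (rule inj_onI, rule ccontr)
    fix p q assume "p \<in> P" "q \<in> P" "lev p = lev q" "p \<noteq> q"
    then show False using lev(2)[of p q] by simp
  qed
  define S where "S = lev ` P"
  \<comment> \<open>Exactly \<open>K\<close> levels remain after the paths have taken theirs, one
    for each index of the zigzag.\<close>
  have S: "S \<subseteq> {..<N}" "N - card S = K" using lev(1) lev_inj by (auto simp: S_def card_image N_def)
  have "Suc i \<notin> S" if "i \<in> S" for i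
  proof
    assume "Suc i \<in> S"
    then obtain q where q: "q \<in> P" "Suc i = lev q" unfolding S_def by (rule imageE)
    from \<open>i \<in> S\<close> obtain p where p: "p \<in> P" "i = lev p" unfolding S_def by (rule imageE)
    have "p \<noteq> q" using p(2) q(2) by auto
    from lev(2)[OF p(1) q(1) this] show False unfolding p(2)[symmetric] q(2)[symmetric] by simp
  qed
  from enumerate_complement_of_sparse_set[OF S(1) this]
  obtain L where L: "bij_betw L {..<K} ({..<N} - S)" "\<And>i j. i < j \<Longrightarrow> j < K \<Longrightarrow> L i < L j"
    "\<And>i. Suc i < K \<Longrightarrow> L (Suc i) \<le> L i + 2"
    unfolding S(2) by blast

  \<comment> \<open>The labelling and its bijectivity\<close>
  define l where "l e = (if e \<in> St then \<mu> e else if e \<in> RY then priv (rk (snd e))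
      else if e \<in> fst ` P then (let q = inv_into P fst e in ?val (lev q) (b q))
      else if e \<in> snd ` P then (let q = inv_into P snd e in ?val (lev q) (\<not> b q))
      else if e \<in> lo ` {..<K} then A + int (L (inv_into {..<K} lo e))
      else C - (A + int (L (inv_into {..<K} hi e))))" for e
  have l_St: "l e = \<mu> e" if "e \<in> St" for e using that by (simp add: l_def)
  have l_RY: "l (r y) = priv (rk y)" if "y \<in> Y" for y
  proof -
    have "r y \<in> RY" using that by (simp add: RY_def)
    then show ?thesis using Gsnd(1)[OF rs(1)[OF that] that] by (simp add: l_def St_def)
  qed
  have l_fst: "l (fst q) = ?val (lev q) (b q)" if "q \<in> P" for q
  proof -
    have "fst q \<in> fst ` P" "fst q \<in> RX" using that by (auto simp: RX_def)
    moreover from this have "fst q \<notin> St" "fst q \<notin> RY" using RX_RY by (auto simp: St_def)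
    ultimately show ?thesis using that P(5) by (simp add: l_def)
  qed
  have l_snd: "l (snd q) = ?val (lev q) (\<not> b q)" if "q \<in> P" for q
  proof -
    have "snd q \<in> snd ` P" "snd q \<in> RX" using that by (auto simp: RX_def)
    moreover from this have "snd q \<notin> St" "snd q \<notin> RY" "snd q \<notin> fst ` P" using RX_RY P(7) by (auto simp: St_def)
    ultimately show ?thesis using that P(6) by (simp add: l_def)
  qed
  have F_other: "e \<notin> St" "e \<notin> RY" "e \<notin> fst ` P" "e \<notin> snd ` P" if "e \<in> F" for e
    using that F_RX F_RY by (auto simp: St_def RX_def)
  have l_lo: "l (lo i) = A + int (L i)" if "i < K" for i
  proof -
    have "lo i \<in> F" "lo i \<in> lo ` {..<K}" using that zz(5) by auto
    then show ?thesis using F_other[of "lo i"] that zz(2) by (simp add: l_def)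
  qed
  have l_hi: "l (hi i) = C - (A + int (L i))" if "i < K" for i
  proof -
    have "hi i \<in> F" "hi i \<notin> lo ` {..<K}" using that zz(4,5) by auto
    then show ?thesis using F_other[of "hi i"] that zz(3) by (simp add: l_def)
  qed

  have "Lab \<subseteq> l ` E"
  proof
    fix t assume t: "t \<in> Lab"
    consider "t \<in> Lab - Reg - T" | "t \<in> T" | "t \<in> Reg" using t by blast
    then show "t \<in> l ` E"
    proof cases
      case 1
      then obtain e where "e \<in> St" "\<mu> e = t" using \<mu> by (metis bij_betw_imp_surj_on imageE)
      then have "t = l e" "e \<in> E" using l_St[of e] by (auto simp: St_def)
      then show ?thesis by (rule image_eqI)
    next
      case 2
      then obtain k where "k < card Y" "t = priv k" by (auto simp: T_def)
      moreover from this obtain y where "y \<in> Y" "rk y = k"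
        using rk(1) by (metis bij_betw_imp_surj_on imageE lessThan_iff)
      ultimately show ?thesis using l_RY rs(1) Gsnd(2) by (metis image_eqI)
    next
      case 3
      \<comment> \<open>The level of \<open>t\<close>: the lower half of \<open>Reg\<close> counts
        upwards from \<open>A\<close>, the upper half downwards from \<open>C - A\<close>.\<close>
      define j where "j = nat (if t \<le> int M + int N then t - A else C - A - t)"
      have j: "j < N" "t = A + int j \<or> t = C - (A + int j)"
        using 3 by (auto simp: j_def A_def C_def Reg_def)
      show ?thesis
      proof (cases "j \<in> S")
        case True
        then obtain q where q: "q \<in> P" "lev q = j" by (auto simp: S_def)
        then have "t = l (fst q) \<or> t = l (snd q)" using j(2) by (auto simp: l_fst l_snd)
        moreover have "fst q \<in> E" "snd q \<in> E" using q RX_E by (auto simp: RX_def)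
        ultimately show ?thesis by auto
      next
        case False
        then obtain i where i: "i < K" "L i = j"
          using j(1) L(1) by (metis DiffI bij_betw_imp_surj_on imageE lessThan_iff)
        then have "t = l (lo i) \<or> t = l (hi i)" using j(2) by (auto simp: l_lo l_hi)
        moreover have "lo i \<in> E" "hi i \<in> E" using i zz(5) F_E by auto
        ultimately show ?thesis by auto
      qed
    qed
  qed
  then have bij: "bij_betw l E Lab"
    using finE T(6) by (intro bij_betw_if_covers) auto

  \<comment> \<open>Sums on the two sides\<close>
  have sumSt: "(\<Sum>e\<in>St. of_bool (p e) * l e) = (\<Sum>e\<in>St. of_bool (p e) * \<mu> e)" for p
    using l_St by (intro sum.cong) auto
  have sumRY: "(\<Sum>e\<in>RY. g e) = (\<Sum>y\<in>Y. g (r y))" for g :: "'a \<times> 'b \<Rightarrow> int"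
    unfolding RY_def using r_inj by (simp add: sum.reindex)
  have sumRX: "(\<Sum>e\<in>RX. g e) = (\<Sum>q\<in>P. g (fst q) + g (snd q))" for g :: "'a \<times> 'b \<Rightarrow> int"
    unfolding RX_def using P(1,5,6,7)
    by (subst sum.union_disjoint) (auto simp: sum.reindex sum.distrib)

  have "\<alpha> x + (\<Sum>e\<in>E. of_bool (fst e = x) * l e) =
      \<phi>X x + (\<Sum>p\<in>P. of_bool ((fst \<circ> fst) p = x) * ?val (lev p) (b p)
                           + of_bool ((fst \<circ> snd) p = x) * ?val (lev p) (\<not> b p))" for x
  proof -
    have "(\<Sum>e\<in>F. of_bool (fst e = x) * l e) = (\<Sum>i<K. of_bool (fst (lo i) = x) * C)"
      unfolding sumF using zzX l_lo l_hi by (intro sum.cong) (auto simp: algebra_simps)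
    moreover have "(\<Sum>e\<in>RX. of_bool (fst e = x) * l e) =
        (\<Sum>p\<in>P. of_bool ((fst \<circ> fst) p = x) * ?val (lev p) (b p)
               + of_bool ((fst \<circ> snd) p = x) * ?val (lev p) (\<not> b p))"
      unfolding sumRX using l_fst l_snd by (intro sum.cong) auto
    moreover have "(\<Sum>e\<in>RY. of_bool (fst e = x) * l e) = (\<Sum>y\<in>Y. of_bool (fst (r y) = x) * priv (rk y))"
      unfolding sumRY using l_RY by (intro sum.cong) auto
    ultimately show ?thesis unfolding sumE sumSt \<phi>X_def by linarith
  qed
  then have X_inj: "inj_on (\<lambda>x. \<alpha> x + (\<Sum>e\<in>E. of_bool (fst e = x) * l e)) X"
    using inj_on_subset[OF injX cover] by simp

  define \<psi> where "\<psi> y = \<beta> y + (\<Sum>e\<in>E. of_bool (snd e = y) * l e)" for y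
  \<comment> \<open>Each of the at most 3 passages through \<open>y\<close> exceeds its lower bound
    by at most 2, which gives the 6; the private gap of 7 is larger.\<close>
  have Y_bounds: "\<phi>Y y + priv (rk y) \<le> \<psi> y \<and> \<psi> y \<le> \<phi>Y y + priv (rk y) + 6" if "y \<in> Y" for y
  proof -
    have "(\<Sum>e\<in>F. of_bool (snd e = y) * l e) =
        (\<Sum>i<K. of_bool (snd (lo i) = y) * (A + int (L i))) + (\<Sum>i<K. of_bool (snd (hi i) = y) * (C - (A + int (L i))))"
      unfolding sumF sum.distrib[symmetric] using l_lo l_hi by (intro sum.cong) auto
    also have "\<dots> = (\<Sum>i<K. of_bool (snd (hi i) = y) * (C + (int (L (\<tau> i)) - int (L i))))"
      unfolding loY sum.distrib[symmetric] by (intro sum.cong) (auto simp: algebra_simps)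
    finally have sF: "(\<Sum>e\<in>F. of_bool (snd e = y) * l e) =
        (\<Sum>i<K. of_bool (snd (hi i) = y) * (C + (int (L (\<tau> i)) - int (L i))))" .
    have sRX: "(\<Sum>e\<in>RX. of_bool (snd e = y) * l e) = (\<Sum>q\<in>P. of_bool (snd (fst q) = y) * C)"
      unfolding sumRX using l_fst l_snd P10(1) by (intro sum.cong) (auto simp: algebra_simps)
    have "(\<Sum>e\<in>RY. of_bool (snd e = y) * l e) = (\<Sum>y'\<in>Y. of_bool (y' = y) * priv (rk y'))"
      unfolding sumRY using l_RY Gsnd(1)[OF rs(1)] by (intro sum.cong) auto
    also have "\<dots> = priv (rk y)"
      using that fin by (simp add: of_bool_def if_distrib[of "\<lambda>t. t * _"] sum.delta cong: if_cong)
    finally have sRY: "(\<Sum>e\<in>RY. of_bool (snd e = y) * l e) = priv (rk y)" .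
    have \<delta>: "\<delta> i \<le> int (L (\<tau> i)) - int (L i) \<and> int (L (\<tau> i)) - int (L i) \<le> \<delta> i + 2" if "i < K" for i
    proof -
      have "\<tau> i < K" using bij_betw_apply[OF \<tau>(1), of i] that by simp
      with stretched_step_bounds[of K L i "\<tau> i"] L(2,3) \<tau>(3)[OF that] that
      show ?thesis unfolding \<delta>_def by blast
    qed
    have "(\<Sum>i<K. of_bool (snd (hi i) = y) * (C + \<delta> i)) \<le>
        (\<Sum>i<K. of_bool (snd (hi i) = y) * (C + (int (L (\<tau> i)) - int (L i))))"
      using \<delta> by (intro sum_mono mult_left_mono) auto
    moreover have "(\<Sum>i<K. of_bool (snd (hi i) = y) * (C + (int (L (\<tau> i)) - int (L i)))) \<le>
        (\<Sum>i<K. of_bool (snd (hi i) = y) * (C + \<delta> i) + 2 * of_bool (snd (hi i) = y))"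
      using \<delta> by (intro sum_mono) auto
    moreover have "\<dots> \<le> (\<Sum>i<K. of_bool (snd (hi i) = y) * (C + \<delta> i)) + 6"
      using passes[OF that] by (simp add: sum.distrib sum_distrib_left[symmetric])
    ultimately show ?thesis
      unfolding \<psi>_def \<phi>Y_def sumE sumSt sF sRX sRY by linarith
  qed
  have "inj_on \<psi> Y"
  proof (rule inj_on_if_increasing_along)
    show "inj_on rk Y" using rk(1) by (rule bij_betw_imp_inj_on)
    fix y y' assume y: "y \<in> Y" "y' \<in> Y" "rk y < rk y'"
    then have "priv (rk y) + 7 \<le> priv (rk y')" by (simp add: priv_def)
    then show "\<psi> y < \<psi> y'" using Y_bounds[OF y(1)] Y_bounds[OF y(2)] rk(2)[OF y] by linarith
  qed
  then have "inj_on (\<lambda>y. \<beta> y + (\<Sum>e\<in>E. of_bool (snd e = y) * l e)) Y"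
    by (simp add: \<psi>_def[abs_def])
  with bij X_inj show ?thesis unfolding Lab_def by (rule that)
qed

section \<open>Maximum cuts\<close>

text \<open>Moving \<open>v\<close> to the other side exchanges its inner and its cross edges and
  leaves all other edges as they were, so in a maximum cut no vertex has more inner than cross
  edges. Replacing \<open>S\<close> by its complement makes \<open>S\<close> the smaller
  side.\<close>

lemma max_cut:
  assumes V: "finite V" and R: "R \<subseteq> V \<times> V" and sym: "\<And>u v. (u, v) \<in> R \<Longrightarrow> (v, u) \<in> R"
    and irrefl: "\<And>v. (v, v) \<notin> R"
  obtains S where "S \<subseteq> V" "card S \<le> card (V - S)"
    "\<And>v. card {u. (v, u) \<in> R \<and> (u \<in> S \<longleftrightarrow> v \<in> S)} \<le> card {u. (v, u) \<in> R \<and> (u \<in> S \<longleftrightarrow> v \<notin> S)}"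
proof -
  define D where "D S = {p \<in> R. fst p \<in> S \<longleftrightarrow> snd p \<notin> S}" for S
  have finR: "finite R" using V R by (meson finite_SigmaI finite_subset)
  have finN: "finite {u. (v, u) \<in> R \<and> P u}" for v P
    by (rule finite_subset[of _ V]) (use R V in auto)
  have "finite (Pow V)" using V by simp
  then have "Max ((card \<circ> D) ` Pow V) \<in> (card \<circ> D) ` Pow V"
    by (intro Max_in) auto
  then obtain S where S: "S \<subseteq> V" and "card (D S) = Max ((card \<circ> D) ` Pow V)" by auto
  then have max: "card (D S') \<le> card (D S)" if "S' \<subseteq> V" for S'
    using that \<open>finite (Pow V)\<close> by simp
  have loc: "card {u. (v, u) \<in> R \<and> (u \<in> S \<longleftrightarrow> v \<in> S)} \<le> card {u. (v, u) \<in> R \<and> (u \<in> S \<longleftrightarrow> v \<notin> S)}" for v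
  proof (cases "v \<in> V")
    case True
    define I where "I = {u. (v, u) \<in> R \<and> (u \<in> S \<longleftrightarrow> v \<in> S)}"
    define C where "C = {u. (v, u) \<in> R \<and> (u \<in> S \<longleftrightarrow> v \<notin> S)}"
    have fin: "finite I" "finite C" unfolding I_def C_def by (rule finN)+
    have vIC: "v \<notin> I" "v \<notin> C" using irrefl by (auto simp: I_def C_def)
    define S' where "S' = (if v \<in> S then S - {v} else insert v S)"
    have S': "S' \<subseteq> V" "\<And>u. u \<noteq> v \<Longrightarrow> u \<in> S' \<longleftrightarrow> u \<in> S" "v \<in> S' \<longleftrightarrow> v \<notin> S"
      using S True by (auto simp: S'_def)
    have two: "card ({v} \<times> A \<union> A \<times> {v}) = 2 * card A" if "finite A" "v \<notin> A" for A :: "'a set"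
      using that by (subst card_Un_disjoint) (auto simp: card_cartesian_product)
    \<comment> \<open>The part of the cut away from \<open>v\<close>. The rest consists of both arcs
      between \<open>v\<close> and each vertex of \<open>C\<close>, or of \<open>I\<close> once
      \<open>v\<close> has moved; hence the factor 2.\<close>
    define D0 where "D0 = {p \<in> D S. fst p \<noteq> v \<and> snd p \<noteq> v}"
    have D0: "finite D0" "D0 \<inter> ({v} \<times> A \<union> A \<times> {v}) = {}" for A
      using finR by (auto simp: D0_def D_def)
    have plus: "card (D0 \<union> ({v} \<times> A \<union> A \<times> {v})) = card D0 + 2 * card A" if "finite A" "v \<notin> A" for A
      unfolding two[OF that, symmetric] using that D0 by (intro card_Un_disjoint) auto
    have "p \<in> D S \<longleftrightarrow> p \<in> D0 \<union> ({v} \<times> C \<union> C \<times> {v})"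
      "p \<in> D S' \<longleftrightarrow> p \<in> D0 \<union> ({v} \<times> I \<union> I \<times> {v})" for p
    proof -
      obtain a b where p: "p = (a, b)" by (cases p)
      have R_iff: "(a, b) \<in> R \<longleftrightarrow> (b, a) \<in> R" using sym by blast
      consider "a = v" "b = v" | "a = v" "b \<noteq> v" | "a \<noteq> v" "b = v" | "a \<noteq> v" "b \<noteq> v" by blast
      then show "p \<in> D S \<longleftrightarrow> p \<in> D0 \<union> ({v} \<times> C \<union> C \<times> {v})"
        "p \<in> D S' \<longleftrightarrow> p \<in> D0 \<union> ({v} \<times> I \<union> I \<times> {v})"
        using irrefl[of v] R_iff S'(2)[of a] S'(2)[of b] S'(3) unfolding p D0_def D_def I_def C_def
        by (cases; simp; blast)+
    qed
    then have "D S = D0 \<union> ({v} \<times> C \<union> C \<times> {v})" "D S' = D0 \<union> ({v} \<times> I \<union> I \<times> {v})"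
      by blast+
    then show ?thesis
      using max[OF S'(1)] plus[OF fin(1) vIC(1)] plus[OF fin(2) vIC(2)]
      unfolding I_def[symmetric] C_def[symmetric] by simp
  next
    case False
    then have "{u. (v, u) \<in> R \<and> (u \<in> S \<longleftrightarrow> v \<in> S)} = {}" using R by auto
    then show ?thesis by (metis card.empty le0)
  qed
  show ?thesis
  proof (cases "card S \<le> card (V - S)")
    case True
    then show ?thesis using S loc by (intro that)
  next
    case False
    define S' where "S' = V - S"
    have "V - S' = S" using S by (auto simp: S'_def)
    moreover have "{u. (v, u) \<in> R \<and> (u \<in> S' \<longleftrightarrow> v \<in> S')} = {u. (v, u) \<in> R \<and> (u \<in> S \<longleftrightarrow> v \<in> S)}"
      "{u. (v, u) \<in> R \<and> (u \<in> S' \<longleftrightarrow> v \<notin> S')} = {u. (v, u) \<in> R \<and> (u \<in> S \<longleftrightarrow> v \<notin> S)}" for v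
      using R by (auto simp: S'_def)
    ultimately show ?thesis using loc False by (intro that[of S']) (auto simp: S'_def)
  qed
qed

lemma sum_of_bool_int:
  assumes "finite A"
  shows "(\<Sum>a\<in>A. of_bool (P a)) = int (card {a \<in> A. P a})"
  using assms by (simp add: sum_of_bool_eq Int_def)

section \<open>Assembling the orientation\<close>

theorem theorem4:
  fixes G :: "'a pair_pre_digraph"
  assumes "pair_graph G"
    and "min_degree G \<ge> 33"
  shows "admits_antimagic_orientation G"
proof -
  interpret pair_graph G by fact
  let ?V = "pverts G" and ?R = "parcs G"
  have finV: "finite ?V" and finR: "finite ?R" by auto
  have RV: "?R \<subseteq> ?V \<times> ?V" by (intro subsetI) (simp add: mem_Times_iff arc_fst_in_verts arc_snd_in_verts)
  have sym: "(v, u) \<in> ?R" if "(u, v) \<in> ?R" for u v using that arcs_symmetric by auto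
  have irrefl: "(v, v) \<notin> ?R" for v using pair_no_loops[of "(v, v)"] by auto
  obtain X where X: "X \<subseteq> ?V" and card_XY: "card X \<le> card (?V - X)" and
    cut: "\<And>v. card {u. (v, u) \<in> ?R \<and> (u \<in> X \<longleftrightarrow> v \<in> X)} \<le> card {u. (v, u) \<in> ?R \<and> (u \<in> X \<longleftrightarrow> v \<notin> X)}"
    using max_cut[OF finV RV sym irrefl] by blast
  define Y where "Y = ?V - X"
  have finXY: "finite X" "finite Y" using finite_subset[OF X finV] finV by (simp_all add: Y_def)
  define inner where "inner v = {u. (v, u) \<in> ?R \<and> (u \<in> X \<longleftrightarrow> v \<in> X)}" for v
  define cross where "cross v = {u. (v, u) \<in> ?R \<and> (u \<in> X \<longleftrightarrow> v \<notin> X)}" for v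
  have fin_nbrs: "finite (inner v)" "finite (cross v)" for v
    using RV finV by (auto simp: inner_def cross_def intro: finite_subset[of _ ?V])
  \<comment> \<open>At least 33 edges meet \<open>v\<close>, and no more of them are inner than
    cross, so at least 17 are cross edges.\<close>
  have cross_ge: "card (cross v) \<ge> 17" if "v \<in> ?V" for v
  proof -
    have "min_degree G \<le> out_degree (with_proj G) v"
      unfolding min_degree_def using finV that by (intro Min_le) auto
    then have "33 \<le> out_degree (with_proj G) v" using assms(2) by simp
    also have "\<dots> = card (Pair v ` (inner v \<union> cross v))"
      unfolding out_degree_def out_arcs_def by (rule arg_cong[where f = card]) (auto simp: inner_def cross_def)
    also have "\<dots> = card (inner v \<union> cross v)" by (intro card_image) (auto simp: inj_on_def)
    also have "\<dots> \<le> card (inner v) + card (cross v)" by (rule card_Un_le)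
    finally show ?thesis using cut[of v] by (simp add: inner_def cross_def)
  qed
  define E where "E = {e \<in> ?R. fst e \<in> X \<and> snd e \<in> Y}"
  have E_sub: "E \<subseteq> X \<times> Y" by (auto simp: E_def)
  have E_X: "card {e \<in> E. fst e = x} = card (cross x)" if "x \<in> X" for x
  proof -
    have "{e \<in> E. fst e = x} = Pair x ` cross x"
      using that RV by (auto simp: E_def cross_def Y_def)
    then show ?thesis by (simp add: card_image inj_on_def)
  qed
  have E_Y: "card {e \<in> E. snd e = y} = card (cross y)" if "y \<in> Y" for y
  proof -
    have "{e \<in> E. snd e = y} = (\<lambda>u. (u, y)) ` cross y"
    proof -
      have "(u, y) \<in> ?R \<longleftrightarrow> (y, u) \<in> ?R" for u using sym by blast
      then show ?thesis using that RV by (auto simp: E_def cross_def Y_def)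
    qed
    then show ?thesis by (simp add: card_image inj_on_def)
  qed
  \<comment> \<open>An arbitrary numbering of the vertices, used only to direct each inner edge from
    its smaller to its larger end.\<close>
  obtain f :: "'a \<Rightarrow> nat" where f: "inj_on f ?V" using finite_imp_inj_to_nat_seg[OF finV] by blast
  define I where "I = {e \<in> ?R. (fst e \<in> X \<longleftrightarrow> snd e \<in> X) \<and> f (fst e) < f (snd e)}"
  have finEI: "finite E" "finite I" "E \<inter> I = {}"
    using finR by (auto simp: E_def I_def Y_def)
  define M where "M = card I"
  have "card I = card {1..int M}" by (simp add: M_def)
  from finite_same_card_bij[OF finEI(2) _ this]
  obtain \<mu> where \<mu>: "bij_betw \<mu> I {1..int M}" by auto
  define w where "w v = (\<Sum>e\<in>I. (of_bool (snd e = v) - of_bool (fst e = v)) * \<mu> e)" for v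
  \<comment> \<open>At most \<open>card (cross v)\<close> inner edges meet \<open>v\<close>, and
    their labels lie between 1 and \<open>M\<close>.\<close>
  have w_bound: "\<bar>w v\<bar> \<le> int M * int (card (cross v))" if "v \<in> ?V" for v
  proof -
    have \<mu>_le: "0 \<le> \<mu> e" "\<mu> e \<le> int M" if "e \<in> I" for e
      using bij_betw_apply[OF \<mu> that] by auto
    let ?J = "{e \<in> I. fst e = v \<or> snd e = v}"
    have "?J \<subseteq> (\<lambda>u. if f u < f v then (u, v) else (v, u)) ` inner v"
    proof
      fix e assume "e \<in> ?J"
      moreover obtain a b where e: "e = (a, b)" by (cases e)
      ultimately have *: "(a, b) \<in> ?R" "a \<in> X \<longleftrightarrow> b \<in> X" "f a < f b" "a = v \<or> b = v" by (auto simp: I_def)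
      show "e \<in> (\<lambda>u. if f u < f v then (u, v) else (v, u)) ` inner v"
      proof (cases "a = v")
        case True
        then have "b \<in> inner v" "e = (if f b < f v then (b, v) else (v, b))"
          using * e by (auto simp: inner_def)
        then show ?thesis by blast
      next
        case False
        then have "a \<in> inner v" "e = (if f a < f v then (a, v) else (v, a))"
          using * e sym by (auto simp: inner_def)
        then show ?thesis by blast
      qed
    qed
    then have "card ?J \<le> card (inner v)" using fin_nbrs by (meson surj_card_le)
    also have "\<dots> \<le> card (cross v)" using cut[of v] by (simp add: inner_def cross_def)
    finally have J: "card ?J \<le> card (cross v)" .
    have "\<bar>w v\<bar> \<le> (\<Sum>e\<in>I. \<bar>(of_bool (snd e = v) - of_bool (fst e = v)) * \<mu> e\<bar>)"
      unfolding w_def by (rule sum_abs)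
    also have "\<dots> \<le> (\<Sum>e\<in>I. int M * of_bool (fst e = v \<or> snd e = v))"
      using \<mu>_le by (intro sum_mono) auto
    also have "\<dots> = int M * int (card ?J)"
      using sum_of_bool_int[OF finEI(2), of "\<lambda>e. fst e = v \<or> snd e = v"]
      unfolding sum_distrib_left[symmetric] by (rule arg_cong)
    also have "\<dots> \<le> int M * int (card (cross v))" using J by (intro mult_left_mono) auto
    finally show ?thesis .
  qed
  have dX: "card {e \<in> E. fst e = x} \<ge> 17" if "x \<in> X" for x using E_X that X cross_ge by auto
  have dY: "card {e \<in> E. snd e = y} \<ge> 17" if "y \<in> Y" for y using E_Y that cross_ge by (auto simp: Y_def)
  \<comment> \<open>At \<open>x\<close> in \<open>X\<close> all cross edges leave, so the vertex sum
    is the negative of the expression made injective here; hence the sign of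
    \<open>w x\<close>.\<close>
  obtain l where l: "bij_betw l E {int M + 1..int M + int (card E)}"
    "inj_on (\<lambda>x. - w x + (\<Sum>e\<in>E. of_bool (fst e = x) * l e)) X"
    "inj_on (\<lambda>y. w y + (\<Sum>e\<in>E. of_bool (snd e = y) * l e)) Y"
    using bipartite_labeling[OF finXY E_sub dX dY card_XY[folded Y_def], of M "\<lambda>x. - w x" w] .
  define D where "D = \<lparr>pverts = ?V, parcs = E \<union> I\<rparr>"
  define \<sigma> where "\<sigma> e = (if e \<in> E then l e else \<mu> e)" for e
  have "orientation_of D G"
    unfolding orientation_of_def
  proof (intro conjI allI impI)
    show "pverts D = ?V" by (simp add: D_def)
    show "parcs D \<subseteq> ?R" by (auto simp: D_def E_def I_def)
    fix u v assume uv: "(u, v) \<in> ?R"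
    then have uvV: "u \<in> ?V" "v \<in> ?V" "u \<noteq> v" using RV irrefl by auto
    then have "f u \<noteq> f v" using f by (auto dest: inj_onD)
    then show "((u, v) \<in> parcs D) = ((v, u) \<notin> parcs D)"
      using uv uvV sym[OF uv] by (auto simp: D_def E_def I_def Y_def)
  qed
  moreover have "antimagic_labeling (with_proj D) \<sigma>"
  proof -
    have cardD: "card (E \<union> I) = M + card E"
      using finEI by (simp add: card_Un_disjoint M_def)
    have "\<sigma> e = \<mu> e" if "e \<in> I" for e using that finEI(3) by (auto simp: \<sigma>_def)
    then have "bij_betw \<sigma> I {1..int M}" using \<mu> by (subst bij_betw_cong[of I \<sigma> \<mu>]) auto
    moreover have "bij_betw \<sigma> E {int M + 1..int M + int (card E)}"
      using l(1) by (subst bij_betw_cong[of E \<sigma> l]) (auto simp: \<sigma>_def)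
    ultimately have "bij_betw \<sigma> (I \<union> E) ({1..int M} \<union> {int M + 1..int M + int (card E)})"
      by (rule bij_betw_combine) auto
    also have "I \<union> E = E \<union> I" by (rule Un_commute)
    also have "{1..int M} \<union> {int M + 1..int M + int (card E)} = {1..int (card (E \<union> I))}"
      unfolding cardD by auto
    finally have bij: "bij_betw \<sigma> (E \<union> I) {1..int (card (E \<union> I))}" .
    have vsum: "oriented_vertex_sum (with_proj D) \<sigma> v =
        (\<Sum>e\<in>E. of_bool (snd e = v) * l e) - (\<Sum>e\<in>E. of_bool (fst e = v) * l e) + w v" for v
    proof -
      have part: "(\<Sum>e\<in>{e \<in> E \<union> I. P e}. \<sigma> e) = (\<Sum>e\<in>E. of_bool (P e) * l e) + (\<Sum>e\<in>I. of_bool (P e) * \<mu> e)" for P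
      proof -
        have "(\<Sum>e\<in>{e \<in> E \<union> I. P e}. \<sigma> e) = (\<Sum>e\<in>E \<union> I. if P e then \<sigma> e else 0)"
          by (rule sum.inter_filter) (simp add: finEI)
        also have "\<dots> = (\<Sum>e\<in>E \<union> I. of_bool (P e) * \<sigma> e)"
          by (rule sum.cong) auto
        also have "\<dots> = (\<Sum>e\<in>E. of_bool (P e) * \<sigma> e) + (\<Sum>e\<in>I. of_bool (P e) * \<sigma> e)"
          using finEI by (intro sum.union_disjoint)
        also have "(\<Sum>e\<in>E. of_bool (P e) * \<sigma> e) = (\<Sum>e\<in>E. of_bool (P e) * l e)"
          by (intro sum.cong) (auto simp: \<sigma>_def)
        also have "(\<Sum>e\<in>I. of_bool (P e) * \<sigma> e) = (\<Sum>e\<in>I. of_bool (P e) * \<mu> e)"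
          using finEI(3) by (intro sum.cong) (auto simp: \<sigma>_def)
        finally show ?thesis .
      qed
      have "in_arcs (with_proj D) v = {e \<in> E \<union> I. snd e = v}" "out_arcs (with_proj D) v = {e \<in> E \<union> I. fst e = v}"
        by (auto simp: in_arcs_def out_arcs_def D_def)
      then show ?thesis
        unfolding oriented_vertex_sum_def w_def
        by (simp only: part) (simp add: left_diff_distrib sum_subtractf)
    qed
    have l_ge: "int M + 1 \<le> l e" if "e \<in> E" for e using bij_betw_apply[OF l(1) that] by simp
    \<comment> \<open>Each cross edge has a label of at least \<open>M + 1\<close>, while
      \<open>w_bound\<close> allows only \<open>M\<close> per cross edge; strictness comes from
      \<open>v\<close> having cross edges at all.\<close>
    have big: "\<bar>w v\<bar> < (\<Sum>e\<in>E. of_bool (P e) * l e)"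
      if "v \<in> ?V" "card {e \<in> E. P e} = card (cross v)" for v P
    proof -
      have "\<bar>w v\<bar> < (int M + 1) * int (card {e \<in> E. P e})"
        using w_bound[OF that(1)] cross_ge[OF that(1)] that(2) by (simp add: algebra_simps)
      also have "\<dots> = (\<Sum>e\<in>E. of_bool (P e) * (int M + 1))"
        by (simp only: sum_distrib_right[symmetric] sum_of_bool_int[OF finEI(1)] mult.commute)
      also have "\<dots> \<le> (\<Sum>e\<in>E. of_bool (P e) * l e)"
        using l_ge by (intro sum_mono mult_left_mono) auto
      finally show ?thesis .
    qed
    let ?s = "oriented_vertex_sum (with_proj D) \<sigma>"
    have sX: "?s x = - (- w x + (\<Sum>e\<in>E. of_bool (fst e = x) * l e))" "?s x < 0" if "x \<in> X" for x
    proof -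
      have "(\<Sum>e\<in>E. of_bool (snd e = x) * l e) = 0"
        using that E_sub by (intro sum.neutral) (auto simp: Y_def)
      then show "?s x = - (- w x + (\<Sum>e\<in>E. of_bool (fst e = x) * l e))" by (simp add: vsum)
      then show "?s x < 0" using big[of x "\<lambda>e. fst e = x"] that X E_X by fastforce
    qed
    have sY: "?s y = w y + (\<Sum>e\<in>E. of_bool (snd e = y) * l e)" "?s y > 0" if "y \<in> Y" for y
    proof -
      have "(\<Sum>e\<in>E. of_bool (fst e = y) * l e) = 0"
        using that E_sub by (intro sum.neutral) (auto simp: Y_def)
      then show "?s y = w y + (\<Sum>e\<in>E. of_bool (snd e = y) * l e)" by (simp add: vsum)
      then show "?s y > 0" using big[of y "\<lambda>e. snd e = y"] that E_Y by (fastforce simp: Y_def)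
    qed
    have "inj_on ?s (X \<union> Y)"
    proof (rule inj_onI)
      fix u v assume uv: "u \<in> X \<union> Y" "v \<in> X \<union> Y" "?s u = ?s v"
      then consider "u \<in> X" "v \<in> X" | "u \<in> Y" "v \<in> Y"
        using sX(2)[of u] sX(2)[of v] sY(2)[of u] sY(2)[of v] by fastforce
      then show "u = v"
      proof cases
        case 1
        then show ?thesis using uv(3) sX(1)[of u] sX(1)[of v] inj_onD[OF l(2), of u v] by simp
      next
        case 2
        then show ?thesis using uv(3) sY(1)[of u] sY(1)[of v] inj_onD[OF l(3), of u v] by simp
      qed
    qed
    moreover have "X \<union> Y = ?V" using X by (auto simp: Y_def)
    ultimately show ?thesis
      unfolding antimagic_labeling_def using bij by (simp add: D_def)
  qed
  ultimately show ?thesis unfolding admits_antimagic_orientation_def by blast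
qed

end
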